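(* Fix an integer $d\ge 3$. The graph parameter \[G\mapsto \frac{\ln \operatorname{pm}(G)}{v(G)}\] is not estimable in the class of $d$-regular bipartite simple graphs; that is, there exists a Benjamini--Schramm convergent sequence $(G_n)$ of $d$-regular bipartite simple graphs along which $\ln\operatorname{pm}(G_n)/v(G_n)$ does not converge.
   Context: All graphs are finite. $v(G)$ is the number of vertices and $\operatorname{pm}(G)$ the number of perfect matchings of $G$. For a finite graph $G$, a finite rooted graph $\alpha$ and an integer $r>0$, let $\mathbb P(G,\alpha,r)$ be the probability that the ball of radius $r$ around a uniformly random vertex of $G$ is isomorphic (as a rooted graph) to $\alpha$. A sequence $(G_n)$ of finite graphs with uniformly bounded degrees is Benjamini--Schramm convergent if for every finite rooted graph $\alpha$ and every $r>0$ the sequence $\mathbb P(G_n,\alpha,r)$ converges. A graph parameter $p$ is estimable in a class $\mathcal C$ of finite graphs if $p(G_n)$ converges for every Benjamini--Schramm convergent sequence $(G_n)$ with bounded degrees in $\mathcal C$. *)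

theory Defs
  imports "HOL-Probability.Probability_Mass_Function"
begin

record 'a graph =
  verts :: "'a set"
  edges :: "'a set set"

text \<open>
  Graphs are simple and undirected: an edge is a two-element set of vertices.
  The vertex set is required to be nonempty, so that a uniformly random vertex
  exists and dividing by the number of vertices makes sense.
\<close>

definition fin_simple_graph :: "'a graph \<Rightarrow> bool" where
  "fin_simple_graph G \<longleftrightarrow> finite (verts G) \<and> verts G \<noteq> {} \<and>
     (\<forall>e\<in>edges G. e \<subseteq> verts G \<and> card e = 2)"

definition vdegree :: "'a graph \<Rightarrow> 'a \<Rightarrow> nat" where
  "vdegree G v = card {e \<in> edges G. v \<in> e}"

definition regular :: "nat \<Rightarrow> 'a graph \<Rightarrow> bool" where
  "regular d G \<longleftrightarrow> (\<forall>v\<in>verts G. vdegree G v = d)"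

definition bipartite :: "'a graph \<Rightarrow> bool" where
  "bipartite G \<longleftrightarrow> (\<exists>A B. A \<union> B = verts G \<and> A \<inter> B = {} \<and>
     (\<forall>e\<in>edges G. \<exists>a\<in>A. \<exists>b\<in>B. e = {a, b}))"

definition perfect_matching :: "'a graph \<Rightarrow> 'a set set \<Rightarrow> bool" where
  "perfect_matching G M \<longleftrightarrow> M \<subseteq> edges G \<and> (\<forall>v\<in>verts G. \<exists>!e. e \<in> M \<and> v \<in> e)"

definition pm :: "'a graph \<Rightarrow> nat" where
  "pm G = card {M. perfect_matching G M}"

definition adj_rel :: "'a graph \<Rightarrow> ('a \<times> 'a) set" where
  "adj_rel G = {(u, v). {u, v} \<in> edges G}"

text \<open>
  The vertices at graph distance at most \<open>r\<close> from \<open>v\<close> are those that can be reached from \<open>v\<close> by a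
  walk with at most \<open>r\<close> edges. The ball is the subgraph induced on them, rooted at \<open>v\<close>.
\<close>

definition ball_verts :: "'a graph \<Rightarrow> 'a \<Rightarrow> nat \<Rightarrow> 'a set" where
  "ball_verts G v r = {w \<in> verts G. \<exists>k\<le>r. (v, w) \<in> adj_rel G ^^ k}"

definition induced_subgraph :: "'a graph \<Rightarrow> 'a set \<Rightarrow> 'a graph" where
  "induced_subgraph G S = \<lparr>verts = verts G \<inter> S, edges = {e \<in> edges G. e \<subseteq> S}\<rparr>"

type_synonym 'a rooted_graph = "'a graph \<times> 'a"

definition fin_rooted_graph :: "'a rooted_graph \<Rightarrow> bool" where
  "fin_rooted_graph \<alpha> \<longleftrightarrow> fin_simple_graph (fst \<alpha>) \<and> snd \<alpha> \<in> verts (fst \<alpha>)"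

definition rooted_ball :: "'a graph \<Rightarrow> 'a \<Rightarrow> nat \<Rightarrow> 'a rooted_graph" where
  "rooted_ball G v r = (induced_subgraph G (ball_verts G v r), v)"

definition rooted_iso :: "'a rooted_graph \<Rightarrow> 'b rooted_graph \<Rightarrow> bool" where
  "rooted_iso \<alpha> \<beta> \<longleftrightarrow> (\<exists>f. bij_betw f (verts (fst \<alpha>)) (verts (fst \<beta>)) \<and>
     (\<lambda>e. f ` e) ` edges (fst \<alpha>) = edges (fst \<beta>) \<and> f (snd \<alpha>) = snd \<beta>)"

definition ball_prob :: "'a graph \<Rightarrow> 'b rooted_graph \<Rightarrow> nat \<Rightarrow> real" where
  "ball_prob G \<alpha> r = measure_pmf.prob (pmf_of_set (verts G)) {v. rooted_iso (rooted_ball G v r) \<alpha>}"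

definition bounded_degrees :: "(nat \<Rightarrow> 'a graph) \<Rightarrow> bool" where
  "bounded_degrees Gs \<longleftrightarrow> (\<exists>D. \<forall>n. \<forall>v\<in>verts (Gs n). vdegree (Gs n) v \<le> D)"

text \<open>
  Every finite graph is isomorphic to one whose vertices are natural numbers, so sequences,
  classes and test graphs \<open>\<alpha>\<close> are taken with vertices of type \<^typ>\<open>nat\<close>.
\<close>

definition BS_convergent :: "(nat \<Rightarrow> nat graph) \<Rightarrow> bool" where
  "BS_convergent Gs \<longleftrightarrow> (\<forall>n. fin_simple_graph (Gs n)) \<and> bounded_degrees Gs \<and>
     (\<forall>\<alpha> :: nat rooted_graph. \<forall>r>0. fin_rooted_graph \<alpha> \<longrightarrow>
        convergent (\<lambda>n. ball_prob (Gs n) \<alpha> r))"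

definition estimable :: "nat graph set \<Rightarrow> (nat graph \<Rightarrow> real) \<Rightarrow> bool" where
  "estimable \<C> p \<longleftrightarrow> (\<forall>Gs. (\<forall>n. Gs n \<in> \<C>) \<and> BS_convergent Gs \<longrightarrow>
     convergent (\<lambda>n. p (Gs n)))"

definition regular_bipartite_graphs :: "nat \<Rightarrow> nat graph set" where
  "regular_bipartite_graphs d = {G. fin_simple_graph G \<and> regular d G \<and> bipartite G}"

text \<open>
  In Isabelle/HOL \<open>ln 0 = 0\<close>. This convention plays no role for the \<open>d\<close>-regular bipartite graphs
  with \<open>d \<ge> 1\<close>, which always have a perfect matching.
\<close>

definition pm_entropy :: "nat graph \<Rightarrow> real" where
  "pm_entropy G = ln (real (pm G)) / real (card (verts G))"

end

theory Submission
  imports Defs "HOL-Combinatorics.Permutations"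
begin

text \<open>
  Take \<open>K\<^bsub>d,d\<^esub>\<close> without one edge, and link such gadgets in chains through the two vertices of
  degree \<open>d - 1\<close>. Since the two sides of a gadget have equal size, a perfect matching uses both or
  none of the two links at a gadget, so it uses all or none of the links of a chain. A gadget has
  \<open>A = d! - (d - 1)!\<close> matchings if its links are unused and only \<open>B = (d - 1)! < A\<close> if they are used.
  A cycle of \<open>d * L\<close> gadgets therefore has at least \<open>A ^ (d * L)\<close> perfect matchings. If instead two
  new vertices of degree \<open>d\<close> are joined by \<open>d\<close> chains of \<open>L\<close> gadgets, each new vertex must be matched
  into some chain, so exactly one chain has its links used, and there are at most
  \<open>d * B ^ L * A ^ ((d - 1) * L)\<close> perfect matchings. As \<open>L\<close> grows, almost all balls in both graphs are
  balls of the infinite chain. Hence interleaving the two families gives a Benjamini--Schramm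
  convergent sequence, whereas the entropies of the two subsequences stay apart.
\<close>

section \<open>Bipartite graphs given by a relation\<close>

text \<open>Both colour classes are copies of \<open>A\<close>: \<open>(a, False)\<close> and \<open>(a, True)\<close> are the left and the
  right copy of \<open>a\<close>.\<close>

definition bip_graph :: "'a::countable set \<Rightarrow> ('a \<times> 'a) set \<Rightarrow> nat graph" where
  "bip_graph A R = \<lparr>verts = to_nat ` (A \<times> (UNIV :: bool set)),
     edges = (\<lambda>(a, b). {to_nat (a, False), to_nat (b, True)}) ` R\<rparr>"

lemma verts_bip_graph: "to_nat (a, s :: bool) \<in> verts (bip_graph A R) \<longleftrightarrow> a \<in> A"
  by (auto simp: bip_graph_def)

lemma card_verts_bip_graph: "card (verts (bip_graph A R)) = 2 * card A"
  by (simp add: bip_graph_def card_image card_cartesian_product)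

lemma card_edge_bip_graph: "e \<in> edges (bip_graph A R) \<Longrightarrow> card e = 2"
  by (auto simp: bip_graph_def)

lemma adj_bip_graph:
  "(to_nat (a, s :: bool), w) \<in> adj_rel (bip_graph A R) \<longleftrightarrow>
     (\<exists>b. w = to_nat (b, \<not> s) \<and> (if s then (b, a) \<in> R else (a, b) \<in> R))"
  by (cases s; force simp: adj_rel_def bip_graph_def doubleton_eq_iff image_iff)

lemma fin_simple_bip_graph:
  assumes "finite A" "A \<noteq> {}" "R \<subseteq> A \<times> A"
  shows "fin_simple_graph (bip_graph A R)"
  using assms by (auto simp: fin_simple_graph_def bip_graph_def)

lemma bipartite_bip_graph:
  assumes "R \<subseteq> A \<times> A"
  shows "bipartite (bip_graph A R)"
  unfolding bipartite_def
proof (intro exI conjI)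
  let ?A = "(\<lambda>a. to_nat (a, False)) ` A" and ?B = "(\<lambda>a. to_nat (a, True)) ` A"
  show "?A \<union> ?B = verts (bip_graph A R)"
    by (auto simp: bip_graph_def image_iff)
  show "?A \<inter> ?B = {}" by auto
  show "\<forall>e\<in>edges (bip_graph A R). \<exists>a\<in>?A. \<exists>b\<in>?B. e = {a, b}"
    using assms by (fastforce simp: bip_graph_def)
qed

lemma vdegree_bip_graph:
  "vdegree (bip_graph A R) (to_nat (a, False)) = card (R `` {a})"
  "vdegree (bip_graph A R) (to_nat (a, True)) = card (R\<inverse> `` {a})"
proof -
  have 1: "{e \<in> edges (bip_graph A R). to_nat (a, False) \<in> e} =
      (\<lambda>b. {to_nat (a, False), to_nat (b, True)}) ` (R `` {a})"
    by (auto simp: bip_graph_def)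
  show "vdegree (bip_graph A R) (to_nat (a, False)) = card (R `` {a})"
    unfolding vdegree_def 1 by (intro card_image inj_onI) (simp add: doubleton_eq_iff)
  have 2: "{e \<in> edges (bip_graph A R). to_nat (a, True) \<in> e} =
      (\<lambda>b. {to_nat (b, False), to_nat (a, True)}) ` (R\<inverse> `` {a})"
    by (auto simp: bip_graph_def)
  show "vdegree (bip_graph A R) (to_nat (a, True)) = card (R\<inverse> `` {a})"
    unfolding vdegree_def 2 by (intro card_image inj_onI) (simp add: doubleton_eq_iff)
qed

lemma regular_bip_graph:
  assumes "\<And>a. a \<in> A \<Longrightarrow> card (R `` {a}) = d" "\<And>a. a \<in> A \<Longrightarrow> card (R\<inverse> `` {a}) = d"
  shows "regular d (bip_graph A R)"
  unfolding regular_def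
proof
  fix v assume "v \<in> verts (bip_graph A R)"
  then obtain a and s :: bool where "v = to_nat (a, s)" "a \<in> A" by (auto simp: bip_graph_def)
  then show "vdegree (bip_graph A R) v = d"
    using assms by (cases s) (simp_all add: vdegree_bip_graph)
qed

text \<open>Both colour classes are indexed by the same finite set, so reading each matching edge as
  left index to right index gives an injective self-map of \<open>A\<close>, hence a permutation,
  and the matching can be recovered from it. Counting matchings becomes counting permutations
  constrained by \<open>R\<close>.\<close>

lemma pm_bip_graph:
  assumes "finite A" "R \<subseteq> A \<times> A"
  shows "pm (bip_graph A R) = card {\<pi>. \<pi> permutes A \<and> (\<forall>a\<in>A. (a, \<pi> a) \<in> R)}"
proof -
  let ?G = "bip_graph A R"
  let ?S = "{\<pi>. \<pi> permutes A \<and> (\<forall>a\<in>A. (a, \<pi> a) \<in> R)}"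
  define h where "h a b = {to_nat (a, False), to_nat (b, True)}" for a b :: 'a
  have h_eq: "h a b = h a' b' \<longleftrightarrow> a = a' \<and> b = b'" for a b a' b'
    by (auto simp: h_def doubleton_eq_iff)
  have h_F: "to_nat (c, False) \<in> h a b \<longleftrightarrow> c = a" for a b c by (auto simp: h_def)
  have h_T: "to_nat (c, True) \<in> h a b \<longleftrightarrow> c = b" for a b c by (auto simp: h_def)
  have E: "edges ?G = (\<lambda>(a, b). h a b) ` R" by (simp add: bip_graph_def h_def)
  define F where "F \<pi> = (\<lambda>a. h a (\<pi> a)) ` A" for \<pi>
  have "bij_betw F ?S {M. perfect_matching ?G M}"
    unfolding bij_betw_def
  proof (intro conjI subset_antisym subsetI)
    show "inj_on F ?S"
    proof (rule inj_onI)
      fix \<pi> \<rho> assume a: "\<pi> \<in> ?S" "\<rho> \<in> ?S" "F \<pi> = F \<rho>"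
      show "\<pi> = \<rho>"
      proof
        fix x show "\<pi> x = \<rho> x"
        proof (cases "x \<in> A")
          case True
          then have "h x (\<pi> x) \<in> F \<rho>" using a(3) by (auto simp: F_def)
          then show ?thesis by (auto simp: F_def h_eq)
        qed (use a in \<open>auto simp: permutes_not_in\<close>)
      qed
    qed
  next
    fix M assume "M \<in> F ` ?S"
    then obtain \<pi> where \<pi>: "\<pi> permutes A" "\<And>a. a \<in> A \<Longrightarrow> (a, \<pi> a) \<in> R" "M = F \<pi>" by auto
    have "\<exists>!e. e \<in> M \<and> to_nat (a, s) \<in> e" if "a \<in> A" for a and s :: bool
    proof (cases s)
      case False
      show ?thesis
        by (rule ex1I[of _ "h a (\<pi> a)"]) (use that False in \<open>auto simp: \<pi>(3) F_def h_F\<close>)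
    next
      case True
      let ?b = "inv \<pi> a"
      have b: "?b \<in> A" "\<pi> ?b = a"
        using \<pi>(1) that by (auto simp: permutes_inverses permutes_in_image[OF permutes_inv])
      have u: "x = ?b" if "\<pi> x = a" for x
        using permutes_inverses(2)[OF \<pi>(1), of x] that by simp
      show ?thesis
      proof (rule ex1I[of _ "h ?b a"])
        have "h ?b (\<pi> ?b) \<in> M" unfolding \<pi>(3) F_def using b(1) by (rule imageI)
        then show "h ?b a \<in> M \<and> to_nat (a, s) \<in> h ?b a"
          unfolding b(2) using True by (simp add: h_def)
      next
        fix e assume e: "e \<in> M \<and> to_nat (a, s) \<in> e"
        then obtain x where x: "e = h x (\<pi> x)" by (auto simp: \<pi>(3) F_def)
        then have "\<pi> x = a" using e True h_T by auto
        then show "e = h ?b a" using u[of x] x by simp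
      qed
    qed
    moreover have "M \<subseteq> edges ?G" using \<pi>(2) by (auto simp: \<pi>(3) F_def E)
    ultimately show "M \<in> {M. perfect_matching ?G M}"
      by (auto simp: perfect_matching_def bip_graph_def)
  next
    fix M assume "M \<in> {M. perfect_matching ?G M}"
    then have M: "M \<subseteq> edges ?G" "\<And>a (s :: bool). a \<in> A \<Longrightarrow> \<exists>!e. e \<in> M \<and> to_nat (a, s) \<in> e"
      by (auto simp: perfect_matching_def verts_bip_graph)
    have ex: "\<exists>!b. h a b \<in> M" if a: "a \<in> A" for a
    proof -
      obtain e where e: "e \<in> M \<and> to_nat (a, False) \<in> e"
        and u: "\<forall>e'. e' \<in> M \<and> to_nat (a, False) \<in> e' \<longrightarrow> e' = e"
        using M(2)[OF a, of False] by (rule ex1E)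
      then have "e \<in> (\<lambda>(a, b). h a b) ` R" using M(1) unfolding E by (blast dest: subsetD)
      then obtain x b where "e = h x b" by auto
      then have b: "e = h a b" using e by (simp add: h_F)
      show ?thesis
      proof (rule ex1I[of _ b])
        show "h a b \<in> M" using e b by simp
        show "b' = b" if "h a b' \<in> M" for b'
          using u[rule_format, of "h a b'"] that b by (simp add: h_F h_eq)
      qed
    qed
    \<comment> \<open>The identity outside \<open>A\<close> is what \<open>permutes\<close> demands;
      inside \<open>A\<close> the value is the matched partner.\<close>
    define \<pi> where "\<pi> a = (if a \<in> A then THE b. h a b \<in> M else a)" for a
    have \<pi>: "h a b \<in> M \<longleftrightarrow> b = \<pi> a" if "a \<in> A" for a b
      using theI'[OF ex[OF that]] ex[OF that] that unfolding \<pi>_def by auto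
    have R: "(a, b) \<in> R" if "h a b \<in> M" for a b using that M(1) by (auto simp: E h_eq)
    have "inj_on \<pi> A"
    proof (rule inj_onI)
      fix a b assume ab: "a \<in> A" "b \<in> A" "\<pi> a = \<pi> b"
      then have "h a (\<pi> a) \<in> M" "h b (\<pi> a) \<in> M" using \<pi> by auto
      have "\<pi> a \<in> A" using R[OF \<open>h a (\<pi> a) \<in> M\<close>] assms by auto
      then obtain e where "\<forall>e'. e' \<in> M \<and> to_nat (\<pi> a, True) \<in> e' \<longrightarrow> e' = e"
        using M(2)[of "\<pi> a" True] by (auto elim!: ex1E)
      from this[rule_format, of "h a (\<pi> a)"] this[rule_format, of "h b (\<pi> a)"]
      have "h a (\<pi> a) = h b (\<pi> a)"
        using \<open>h a (\<pi> a) \<in> M\<close> \<open>h b (\<pi> a) \<in> M\<close> by (simp add: h_T)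
      then show "a = b" by (simp add: h_eq)
    qed
    moreover have im: "\<pi> ` A \<subseteq> A" using R \<pi> assms by blast
    ultimately have "\<pi> permutes A"
      using endo_inj_surj[OF assms(1) im]
      by (intro bij_imp_permutes) (auto simp: bij_betw_def \<pi>_def)
    moreover have "M = F \<pi>"
    proof (intro subset_antisym subsetI)
      fix e assume e: "e \<in> M"
      with M(1) E obtain a b where "e = h a b" "(a, b) \<in> R" by auto
      with e assms(2) \<pi> show "e \<in> F \<pi>" by (auto simp: F_def)
    next
      fix e assume "e \<in> F \<pi>" then show "e \<in> M" using \<pi> by (auto simp: F_def)
    qed
    ultimately show "M \<in> F ` ?S" using R \<pi> by auto
  qed
  from bij_betw_same_card[OF this] show ?thesis by (simp add: pm_def)
qed

section \<open>Isomorphic balls\<close>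

text \<open>The inverse map is \<open>inv_into\<close>, which undoes \<open>f\<close> only on the
  vertex set; hence the conditions that the edges and the root lie inside it.\<close>

lemma rooted_iso_sym:
  assumes "rooted_iso \<alpha> \<beta>" "\<And>e. e \<in> edges (fst \<alpha>) \<Longrightarrow> e \<subseteq> verts (fst \<alpha>)" "snd \<alpha> \<in> verts (fst \<alpha>)"
  shows "rooted_iso \<beta> \<alpha>"
proof -
  from assms(1) obtain f where f: "bij_betw f (verts (fst \<alpha>)) (verts (fst \<beta>))"
     "(\<lambda>e. f ` e) ` edges (fst \<alpha>) = edges (fst \<beta>)" "f (snd \<alpha>) = snd \<beta>"
    by (auto simp: rooted_iso_def)
  let ?g = "inv_into (verts (fst \<alpha>)) f"
  have "?g ` f ` e = e" if "e \<in> edges (fst \<alpha>)" for e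
    using assms(2)[OF that] f(1) by (simp add: bij_betw_def inv_into_image_cancel)
  then have "(\<lambda>e. ?g ` e) ` edges (fst \<beta>) = edges (fst \<alpha>)"
    unfolding f(2)[symmetric] image_image by simp
  moreover have "?g (snd \<beta>) = snd \<alpha>" using f assms(3) by (metis bij_betw_inv_into_left)
  ultimately show ?thesis using bij_betw_inv_into[OF f(1)] unfolding rooted_iso_def by blast
qed

lemma rooted_iso_trans:
  assumes "rooted_iso \<alpha> \<beta>" "rooted_iso \<beta> \<gamma>"
  shows "rooted_iso \<alpha> \<gamma>"
proof -
  from assms obtain f g where f: "bij_betw f (verts (fst \<alpha>)) (verts (fst \<beta>))"
     "(\<lambda>e. f ` e) ` edges (fst \<alpha>) = edges (fst \<beta>)" "f (snd \<alpha>) = snd \<beta>"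
    and g: "bij_betw g (verts (fst \<beta>)) (verts (fst \<gamma>))"
     "(\<lambda>e. g ` e) ` edges (fst \<beta>) = edges (fst \<gamma>)" "g (snd \<beta>) = snd \<gamma>"
    by (auto simp: rooted_iso_def)
  have "(\<lambda>e. (g \<circ> f) ` e) ` edges (fst \<alpha>) = edges (fst \<gamma>)"
    unfolding g(2)[symmetric] f(2)[symmetric] by (simp add: image_comp comp_def)
  then show ?thesis
    using bij_betw_trans[OF f(1) g(1)] f(3) g(3) unfolding rooted_iso_def by (metis comp_apply)
qed

text \<open>A local isomorphism criterion. \<open>S k\<close> is any set containing all vertices
  that a walk of \<open>k\<close> edges from \<open>u\<close> can reach. Since \<open>f\<close> maps
  neighbourhoods onto neighbourhoods there, walks from \<open>u\<close> and from \<open>f u\<close>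
  correspond step by step, and injectivity on the union of the \<open>S k\<close> turns this into an
  isomorphism of balls. \<open>H\<close> may be infinite.\<close>

lemma rooted_iso_ball:
  fixes f :: "'a \<Rightarrow> 'b"
  assumes root: "u \<in> S 0"
    and vert: "\<And>k v. k \<le> r \<Longrightarrow> v \<in> S k \<Longrightarrow> v \<in> verts H \<and> f v \<in> verts G"
    and step: "\<And>k v w. k \<le> r \<Longrightarrow> v \<in> S k \<Longrightarrow> (v, w) \<in> adj_rel H \<Longrightarrow> w \<in> S (Suc k)"
    and nbr: "\<And>k v. k \<le> r \<Longrightarrow> v \<in> S k \<Longrightarrow> adj_rel G `` {f v} = f ` (adj_rel H `` {v})"
    and inj: "inj_on f (\<Union>k. S k)"
    and card2: "\<And>e. e \<in> edges G \<Longrightarrow> card e = 2" "\<And>e. e \<in> edges H \<Longrightarrow> card e = 2"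
  shows "rooted_iso (rooted_ball H u r) (rooted_ball G (f u) r)"
proof -
  have walk: "(u, w) \<in> adj_rel H ^^ k \<Longrightarrow> w \<in> S k" if "k \<le> Suc r" for k w
    using that
  proof (induction k arbitrary: w)
    case (Suc k)
    then show ?case using step[of k] by auto
  qed (use root in auto)
  have walkG: "(f u, w) \<in> adj_rel G ^^ k \<longleftrightarrow> (\<exists>w'. (u, w') \<in> adj_rel H ^^ k \<and> w = f w')"
    if "k \<le> Suc r" for k w
    using that
  proof (induction k arbitrary: w)
    case (Suc k)
    have "(f u, w) \<in> adj_rel G ^^ Suc k \<longleftrightarrow>
        (\<exists>v. (u, v) \<in> adj_rel H ^^ k \<and> w \<in> adj_rel G `` {f v})"
      using Suc by auto
    moreover have "adj_rel G `` {f v} = f ` (adj_rel H `` {v})" if "(u, v) \<in> adj_rel H ^^ k" for v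
      using that nbr[of k] walk[of k] Suc.prems by simp
    ultimately have "(f u, w) \<in> adj_rel G ^^ Suc k \<longleftrightarrow>
        (\<exists>v. (u, v) \<in> adj_rel H ^^ k \<and> w \<in> f ` (adj_rel H `` {v}))"
      by metis
    then show ?case by auto
  qed auto
  let ?B = "ball_verts H u r"
  have BS: "\<exists>k\<le>r. v \<in> S k" if "v \<in> ?B" for v
    using that walk by (auto simp: ball_verts_def)
  have BG: "ball_verts G (f u) r = f ` ?B"
  proof (intro subset_antisym subsetI)
    fix w assume "w \<in> ball_verts G (f u) r"
    then obtain k where k: "k \<le> r" "(f u, w) \<in> adj_rel G ^^ k" by (auto simp: ball_verts_def)
    then obtain w' where w': "(u, w') \<in> adj_rel H ^^ k" "w = f w'" using walkG[of k] by auto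
    with walk[of k] vert[of k] k show "w \<in> f ` ?B" by (force simp: ball_verts_def)
  next
    fix w assume "w \<in> f ` ?B"
    then obtain w' k where w': "w = f w'" "k \<le> r" "(u, w') \<in> adj_rel H ^^ k"
      by (auto simp: ball_verts_def)
    then have "(f u, w) \<in> adj_rel G ^^ k" using walkG[of k w] by auto
    moreover have "w \<in> verts G" using w' walk[of k w'] vert[of k w'] by simp
    ultimately show "w \<in> ball_verts G (f u) r" using w'(2) by (auto simp: ball_verts_def)
  qed
  have injB: "inj_on f ?B" by (rule inj_on_subset[OF inj]) (use BS in blast)
  have vB: "verts H \<inter> ?B = ?B" "verts G \<inter> f ` ?B = f ` ?B"
    using BS vert by blast+
  have "(\<lambda>e. f ` e) ` {e \<in> edges H. e \<subseteq> ?B} = {e \<in> edges G. e \<subseteq> f ` ?B}"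
  proof (intro subset_antisym subsetI)
    fix e' assume "e' \<in> (\<lambda>e. f ` e) ` {e \<in> edges H. e \<subseteq> ?B}"
    then obtain e where e: "e' = f ` e" "e \<in> edges H" "e \<subseteq> ?B" by auto
    then obtain a b where ab: "e = {a, b}" using card2(2)[of e] by (auto simp: card_2_iff)
    with e have "a \<in> ?B" by simp
    with BS obtain k where "k \<le> r" "a \<in> S k" by blast
    moreover have "(a, b) \<in> adj_rel H" using e ab by (auto simp: adj_rel_def)
    ultimately have "(f a, f b) \<in> adj_rel G" using nbr[of k a] by auto
    then show "e' \<in> {e \<in> edges G. e \<subseteq> f ` ?B}" using e ab by (auto simp: adj_rel_def)
  next
    fix e' assume e': "e' \<in> {e \<in> edges G. e \<subseteq> f ` ?B}"
    then obtain x y where "e' = {x, y}" using card2(1)[of e'] by (auto simp: card_2_iff)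
    with e' obtain a b where ab: "e' = {f a, f b}" "a \<in> ?B" "b \<in> ?B" by auto
    with BS obtain k l where k: "k \<le> r" "a \<in> S k" "b \<in> S l" by metis
    have "(f a, f b) \<in> adj_rel G" using e' ab by (auto simp: adj_rel_def)
    then have "f b \<in> f ` (adj_rel H `` {a})" using nbr[OF k(1,2)] by auto
    then obtain b' where b': "(a, b') \<in> adj_rel H" "f b = f b'" by auto
    \<comment> \<open>The neighbour \<open>b'\<close> comes from lifting an edge of \<open>G\<close>
      and might lie one step beyond the radius; injectivity on the whole union identifies it with
      \<open>b\<close>.\<close>
    then have "b' \<in> S (Suc k)" using step k by auto
    then have "b = b'" using inj b' k by (auto dest: inj_onD)
    then have "{a, b} \<in> edges H" using b' by (auto simp: adj_rel_def)
    then show "e' \<in> (\<lambda>e. f ` e) ` {e \<in> edges H. e \<subseteq> ?B}" using ab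
      by (intro image_eqI[of _ _ "{a, b}"]) auto
  qed
  with injB show ?thesis
    unfolding rooted_iso_def rooted_ball_def induced_subgraph_def BG
    by (intro exI[of _ f]) (simp add: vB bij_betw_def)
qed

section \<open>Linked gadgets\<close>

text \<open>Each \<open>p \<in> P\<close> carries a copy of \<open>K\<^bsub>d,d\<^esub>\<close> without the edge between its two vertices
  \<open>(p, 0)\<close>. A pair \<open>(p, q) \<in> N\<close> joins the left vertex \<open>(p, 0)\<close> to the right vertex \<open>(q, 0)\<close>. The
  elements of \<open>Q\<close> are hubs, consisting of the two vertices \<open>(q, 0)\<close> only.\<close>

definition gadget_rel :: "nat \<Rightarrow> 'p set \<Rightarrow> ('p \<times> 'p) set \<Rightarrow> (('p \<times> nat) \<times> ('p \<times> nat)) set" where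
  "gadget_rel d P N = {((p, i), (p, j)) | p i j. p \<in> P \<and> i < d \<and> j < d \<and> (i \<noteq> 0 \<or> j \<noteq> 0)}
     \<union> {((p, 0), (q, 0)) | p q. (p, q) \<in> N}"

definition gadget_verts :: "nat \<Rightarrow> 'p set \<Rightarrow> 'p set \<Rightarrow> ('p \<times> nat) set" where
  "gadget_verts d P Q = P \<times> {..<d} \<union> Q \<times> {0}"

text \<open>The numbers of ways to complete a perfect matching inside a gadget, when the two vertices
  \<open>(p, 0)\<close> are matched outside it (\<open>n_out\<close>) or inside it (\<open>n_in\<close>).\<close>

definition n_out :: "nat \<Rightarrow> nat" where
  "n_out d = card {\<pi>. \<pi> permutes {..<d} \<and> \<pi> 0 = 0}"

definition n_in :: "nat \<Rightarrow> nat" where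
  "n_in d = card {\<pi>. \<pi> permutes {..<d} \<and> \<pi> 0 \<noteq> 0}"

text \<open>Permutations fixing \<open>0\<close> are those of \<open>{1..<d}\<close>, so
  \<open>n_out d\<close> is \<open>(d - 1)!\<close>. The complement has
  \<open>d! - (d - 1)! = (d - 1) * (d - 1)!\<close> elements, where the factor \<open>d - 1\<close>
  is at least 2.\<close>

lemma n_out_pos: "0 < n_out d" and n_out_less_n_in: "3 \<le> d \<Longrightarrow> n_out d < n_in d"
proof -
  let ?S = "{\<pi>. \<pi> permutes {..<d}}" and ?O = "{\<pi>. \<pi> permutes {..<d} \<and> \<pi> 0 = 0}"
  have fin: "finite ?S" by (simp add: finite_permutations)
  have "?O = {\<pi>. \<pi> permutes {1..<d}}"
  proof (intro subset_antisym subsetI)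
    fix \<pi> assume "\<pi> \<in> ?O"
    then show "\<pi> \<in> {\<pi>. \<pi> permutes {1..<d}}" by (auto intro!: permutes_superset[of \<pi> "{..<d}"] simp: Suc_le_eq)
  next
    fix \<pi> assume "\<pi> \<in> {\<pi>. \<pi> permutes {1..<d}}"
    then show "\<pi> \<in> ?O" by (auto intro: permutes_subset[of \<pi> "{1..<d}"] simp: permutes_not_in)
  qed
  then have out: "n_out d = fact (d - 1)" by (simp add: n_out_def card_permutations)
  then show "0 < n_out d" by simp
  have "{\<pi>. \<pi> permutes {..<d} \<and> \<pi> 0 \<noteq> 0} = ?S - ?O" by auto
  then have "n_in d = card ?S - n_out d"
    unfolding n_in_def n_out_def using fin by (simp add: card_Diff_subset finite_subset[of ?O ?S] subset_eq)
  then have "n_in d = fact d - n_out d" by (simp add: card_permutations)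
  then show "n_out d < n_in d" if "3 \<le> d"
  proof -
    have "fact d = d * fact (d - 1)" using that by (simp add: fact_reduce)
    then have "n_in d = (d - 1) * fact (d - 1)"
      using \<open>n_in d = fact d - n_out d\<close> out by (simp add: diff_mult_distrib)
    moreover have "2 * fact (d - 1) \<le> (d - 1) * fact (d - 1)" using that by (intro mult_right_mono) auto
    moreover have "0 < (fact (d - 1) :: nat)" by simp
    ultimately show ?thesis using out by linarith
  qed
qed

section \<open>Degrees in graphs of linked gadgets\<close>

lemma gadget_rel_iff:
  "((p, i), (q, j)) \<in> gadget_rel d P N \<longleftrightarrow>
     p = q \<and> p \<in> P \<and> i < d \<and> j < d \<and> (i \<noteq> 0 \<or> j \<noteq> 0) \<or> i = 0 \<and> j = 0 \<and> (p, q) \<in> N"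
  by (auto simp: gadget_rel_def)

text \<open>The gadgets are symmetric, so exchanging left and right only reverses the links. Degrees
  of right vertices thus follow from those of left vertices.\<close>

lemma gadget_rel_converse: "(gadget_rel d P N)\<inverse> = gadget_rel d P (N\<inverse>)"
  by (auto simp: gadget_rel_def)

lemma gadget_rel_subset:
  assumes "0 < d" "N \<subseteq> (P \<union> Q) \<times> (P \<union> Q)"
  shows "gadget_rel d P N \<subseteq> gadget_verts d P Q \<times> gadget_verts d P Q"
  using assms by (auto simp: gadget_rel_def gadget_verts_def)

text \<open>At \<open>(p, 0)\<close> the single link makes up for the edge missing from the
  gadget.\<close>

lemma card_gadget_rel_Image:
  assumes "p \<in> P" "i < d" "N `` {p} = {q}"
  shows "card (gadget_rel d P N `` {(p, i)}) = d"
proof -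
  have N: "(p, x) \<in> N \<longleftrightarrow> x = q" for x using assms(3) by blast
  show ?thesis
  proof (cases "i = 0")
    case True
    have "gadget_rel d P N `` {(p, i)} = insert (q, 0) ({p} \<times> {1..<d})"
      using assms(1,2) True by (auto simp: gadget_rel_iff N)
    then show ?thesis using assms(2) by (simp add: card_cartesian_product)
  next
    case False
    have "gadget_rel d P N `` {(p, i)} = {p} \<times> {..<d}"
      using assms(1,2) False by (auto simp: gadget_rel_iff)
    then show ?thesis by (simp add: card_cartesian_product)
  qed
qed

lemma card_gadget_rel_Image_hub:
  assumes "q \<notin> P"
  shows "card (gadget_rel d P N `` {(q, 0)}) = card (N `` {q})"
proof -
  have "gadget_rel d P N `` {(q, 0)} = N `` {q} \<times> {0}"
    using assms by (auto simp: gadget_rel_iff)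
  then show ?thesis by (simp add: card_cartesian_product)
qed

lemma regular_gadget:
  assumes "P \<inter> Q = {}"
    and "\<And>p. p \<in> P \<Longrightarrow> \<exists>q. N `` {p} = {q}" "\<And>p. p \<in> P \<Longrightarrow> \<exists>q. N\<inverse> `` {p} = {q}"
    and "\<And>q. q \<in> Q \<Longrightarrow> card (N `` {q}) = d" "\<And>q. q \<in> Q \<Longrightarrow> card (N\<inverse> `` {q}) = d"
  shows "regular d (bip_graph (gadget_verts d P Q) (gadget_rel d P N))"
proof -
  have *: "card (gadget_rel d P N' `` {a}) = d"
    if a: "a \<in> gadget_verts d P Q" and single: "\<And>p. p \<in> P \<Longrightarrow> \<exists>q. N' `` {p} = {q}"
      and hub: "\<And>q. q \<in> Q \<Longrightarrow> card (N' `` {q}) = d" for a N'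
  proof -
    from a consider p i where "a = (p, i)" "p \<in> P" "i < d" | q where "a = (q, 0)" "q \<in> Q"
      by (auto simp: gadget_verts_def)
    then show ?thesis
    proof cases
      case 1
      then obtain q where "N' `` {p} = {q}" using single[of p] by auto
      then show ?thesis using 1 by (simp add: card_gadget_rel_Image)
    next
      case 2
      then have "q \<notin> P" using assms(1) by auto
      then show ?thesis using 2 hub by (simp add: card_gadget_rel_Image_hub)
    qed
  qed
  show ?thesis
    by (rule regular_bip_graph) (simp_all add: gadget_rel_converse * assms)
qed

text \<open>Choose in each gadget, independently, a permutation that moves \<open>0\<close> and so
  avoids the missing edge. Together these form a perfect matching that uses no link, and different
  choices give different matchings.\<close>

lemma pm_gadget_lower:
  fixes P :: "'p::countable set"
  assumes "finite P" "0 < d" "N \<subseteq> P \<times> P"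
  shows "n_in d ^ card P \<le> pm (bip_graph (gadget_verts d P {}) (gadget_rel d P N))"
proof -
  let ?V = "P \<times> {..<d}"
  let ?X = "{\<pi>. \<pi> permutes {..<d} \<and> \<pi> 0 \<noteq> 0}"
  let ?Y = "{\<pi>. \<pi> permutes ?V \<and> (\<forall>a\<in>?V. (a, \<pi> a) \<in> gadget_rel d P N)}"
  define F where "F g = (\<lambda>(p, i). if p \<in> P then (p, g p i) else (p :: 'p, i :: nat))" for g
  have V: "gadget_verts d P {} = ?V" by (simp add: gadget_verts_def)
  have "F g \<in> ?Y" if g: "g \<in> Pi\<^sub>E P (\<lambda>_. ?X)" for g
  proof -
    have perm: "g p permutes {..<d}" "g p 0 \<noteq> 0" if "p \<in> P" for p
      using g that by (auto simp: PiE_iff)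
    have F: "F g (p, i) = (p, g p i)" if "p \<in> P" for p i using that by (simp add: F_def)
    have "inj_on (F g) ?V"
    proof (rule inj_onI)
      fix x y assume xy: "x \<in> ?V" "y \<in> ?V" "F g x = F g y"
      then obtain p i j where "x = (p, i)" "y = (p, j)" "p \<in> P" "g p i = g p j"
        by (cases x; cases y) (simp add: F)
      then show "x = y" using injD[OF permutes_inj[OF perm(1)]] by auto
    qed
    moreover have im: "F g ` ?V \<subseteq> ?V"
    proof (rule image_subsetI)
      fix x assume "x \<in> ?V"
      then obtain p i where "x = (p, i)" "p \<in> P" "i < d" by auto
      then show "F g x \<in> ?V" using permutes_in_image[OF perm(1), of p i] by (simp add: F)
    qed
    moreover have "F g x = x" if "x \<notin> ?V" for x
      using that permutes_not_in[OF perm(1), of "fst x" "snd x"] by (cases x) (auto simp: F_def)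
    ultimately have "F g permutes ?V"
      using endo_inj_surj[OF _ im] assms(1)
      by (intro bij_imp_permutes) (simp_all add: bij_betw_def)
    moreover have "(a, F g a) \<in> gadget_rel d P N" if a: "a \<in> ?V" for a
    proof -
      from a obtain p i where pi: "a = (p, i)" "p \<in> P" "i < d" by auto
      have "g p i < d" using permutes_in_image[OF perm(1), of p i] pi by simp
      moreover have "i \<noteq> 0 \<or> g p i \<noteq> 0" using perm(2)[OF pi(2)] by (cases "i = 0") simp_all
      ultimately show ?thesis using pi by (simp add: F gadget_rel_iff)
    qed
    ultimately show ?thesis by auto
  qed
  moreover have "inj_on F (Pi\<^sub>E P (\<lambda>_. ?X))"
  proof (rule inj_onI)
    fix g h assume gh: "g \<in> Pi\<^sub>E P (\<lambda>_. ?X)" "h \<in> Pi\<^sub>E P (\<lambda>_. ?X)" "F g = F h"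
    have "g p = h p" if "p \<in> P" for p
    proof
      fix i show "g p i = h p i" using fun_cong[OF gh(3), of "(p, i)"] that by (simp add: F_def)
    qed
    then show "g = h" using gh(1,2) by (rule PiE_ext[rotated 2])
  qed
  moreover have "finite ?Y" using finite_permutations[of ?V] assms(1) by simp
  ultimately have "card (Pi\<^sub>E P (\<lambda>_. ?X)) \<le> card ?Y" by (intro card_inj_on_le[of F]) auto
  then show ?thesis
    using assms pm_bip_graph[of ?V "gadget_rel d P N"] gadget_rel_subset[of d N P "{}"]
    by (simp add: V card_PiE n_in_def)
qed

section \<open>A fixed perfect matching, seen as a permutation, and its trace on each gadget\<close>

definition leaves :: "('p \<times> nat \<Rightarrow> 'p \<times> nat) \<Rightarrow> 'p \<Rightarrow> bool" where
  "leaves \<pi> p \<longleftrightarrow> fst (\<pi> (p, 0)) \<noteq> p"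

text \<open>If \<open>(p, 0)\<close> is matched outside, \<open>local_perm\<close> fixes \<open>0\<close>, as if the missing edge of the
  gadget were used.\<close>

definition local_perm :: "nat \<Rightarrow> ('p \<times> nat \<Rightarrow> 'p \<times> nat) \<Rightarrow> 'p \<Rightarrow> nat \<Rightarrow> nat" where
  "local_perm d \<pi> p i = (if i < d \<and> fst (\<pi> (p, i)) = p then snd (\<pi> (p, i)) else i)"

context
  fixes d :: nat and P Q :: "'p set" and N :: "('p \<times> 'p) set" and \<pi> :: "'p \<times> nat \<Rightarrow> 'p \<times> nat"
  assumes irrefl: "\<And>p. (p, p) \<notin> N"
    and perm: "\<pi> permutes gadget_verts d P Q"
    and rel: "\<And>a. a \<in> gadget_verts d P Q \<Longrightarrow> (a, \<pi> a) \<in> gadget_rel d P N"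
begin

lemma matched_inside:
  assumes "p \<in> P" "i < d" "i \<noteq> 0 \<or> \<not> leaves \<pi> p"
  obtains j where "\<pi> (p, i) = (p, j)" "j < d" "i \<noteq> 0 \<or> j \<noteq> 0"
proof -
  obtain q j where "\<pi> (p, i) = (q, j)" by fastforce
  with rel[of "(p, i)"] assms irrefl that show ?thesis
    by (auto simp: gadget_rel_iff gadget_verts_def leaves_def)
qed

lemma leaves_link:
  assumes "p \<in> P" "0 < d" "leaves \<pi> p"
  obtains q where "\<pi> (p, 0) = (q, 0)" "(p, q) \<in> N"
proof -
  obtain q j where "\<pi> (p, 0) = (q, j)" by fastforce
  with rel[of "(p, 0)"] assms that show ?thesis
    by (auto simp: gadget_rel_iff gadget_verts_def leaves_def)
qed

text \<open>The two sides of a gadget have equal size: if all \<open>d\<close> left vertices are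
  matched inside, they use up all \<open>d\<close> right vertices.\<close>

lemma matched_inside_image:
  assumes "p \<in> P" "\<not> leaves \<pi> p"
  shows "\<pi> ` ({p} \<times> {..<d}) = {p} \<times> {..<d}"
proof (rule endo_inj_surj)
  show "\<pi> ` ({p} \<times> {..<d}) \<subseteq> {p} \<times> {..<d}"
  proof (rule image_subsetI)
    fix a assume "a \<in> {p} \<times> {..<d}"
    then obtain i where a: "a = (p, i)" "i < d" by auto
    with matched_inside[OF assms(1), of i] assms(2) obtain j where "\<pi> (p, i) = (p, j)" "j < d" by auto
    then show "\<pi> a \<in> {p} \<times> {..<d}" using a by simp
  qed
  show "inj_on \<pi> ({p} \<times> {..<d})" using permutes_inj_on[OF perm] .
qed simp

text \<open>If the left vertex \<open>(p, 0)\<close> is matched outside its gadget, then no left vertex of the gadget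
  other than \<open>(p, 0)\<close> is matched to the right vertex \<open>(p, 0)\<close>, so the latter is matched outside
  as well.\<close>

lemma leaves_image:
  assumes "p \<in> P" "leaves \<pi> p"
  shows "\<pi> ` ({p} \<times> {1..<d}) = {p} \<times> {1..<d}"
proof -
  let ?S = "{p} \<times> {1..<d}"
  \<comment> \<open>The inverse is examined because a right vertex \<open>(p, j)\<close> with
    \<open>j >= 1\<close> has no link: its partner is a left vertex of the same gadget, and it is
    not \<open>(p, 0)\<close>, which is matched elsewhere.\<close>
  have im: "inv \<pi> ` ?S \<subseteq> ?S"
  proof (rule image_subsetI)
    fix a assume a: "a \<in> ?S"
    then have "a \<in> gadget_verts d P Q" using assms by (auto simp: gadget_verts_def)
    then have "inv \<pi> a \<in> gadget_verts d P Q" using permutes_in_image[OF permutes_inv[OF perm]] by simp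
    from rel[OF this] have r: "(inv \<pi> a, a) \<in> gadget_rel d P N"
      using permutes_inverses[OF perm] by simp
    obtain q i where qi: "inv \<pi> a = (q, i)" by fastforce
    have "q = p" "i < d" using r a qi by (auto simp: gadget_rel_iff)
    moreover have "i \<noteq> 0"
    proof
      assume "i = 0"
      then have "\<pi> (p, 0) = a" using qi \<open>q = p\<close> permutes_inverses(1)[OF perm, of a] by simp
      then show False using assms(2) a by (auto simp: leaves_def)
    qed
    ultimately show "inv \<pi> a \<in> ?S" using qi by simp
  qed
  have "inv \<pi> ` ?S = ?S"
    by (rule endo_inj_surj[OF _ im]) (simp_all add: permutes_inj_on[OF permutes_inv[OF perm]])
  then have "\<pi> ` ?S = \<pi> ` inv \<pi> ` ?S" by simp
  also have "\<dots> = ?S" by (simp add: image_image permutes_inverses[OF perm])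
  finally show ?thesis .
qed

text \<open>Otherwise the right vertex \<open>(p, 0)\<close> would already be taken by a left vertex
  of its own gadget.\<close>

lemma leaves_target:
  assumes "p \<in> P" "0 < d" "(q, p) \<in> N" "\<pi> (q, 0) = (p, 0)"
  shows "leaves \<pi> p"
proof (rule ccontr)
  assume "\<not> leaves \<pi> p"
  then have "(p, 0) \<in> \<pi> ` ({p} \<times> {..<d})" using matched_inside_image[OF assms(1)] assms(2) by simp
  then obtain i where "\<pi> (p, i) = \<pi> (q, 0)" using assms(4) by auto
  then have "p = q" using permutes_inj[OF perm] by (auto dest: injD)
  then show False using assms(3) irrefl by simp
qed

text \<open>The left vertices \<open>(p, i)\<close> with \<open>i >= 1\<close> fill exactly the
  right vertices of positive index, so the right vertex \<open>(p, 0)\<close> can only be reached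
  along a link.\<close>

lemma leaves_source:
  assumes "p \<in> P" "0 < d" "leaves \<pi> p"
  obtains q where "(q, p) \<in> N" "\<pi> (q, 0) = (p, 0)"
proof -
  have "(p, 0) \<in> gadget_verts d P Q" using assms by (auto simp: gadget_verts_def)
  then have "inv \<pi> (p, 0) \<in> gadget_verts d P Q"
    using permutes_in_image[OF permutes_inv[OF perm]] by simp
  from rel[OF this] have r: "(inv \<pi> (p, 0), (p, 0)) \<in> gadget_rel d P N"
    using permutes_inverses[OF perm] by simp
  obtain q i where qi: "inv \<pi> (p, 0) = (q, i)" by fastforce
  then have \<pi>: "\<pi> (q, i) = (p, 0)" using permutes_inverses(1)[OF perm, of "(p, 0)"] by simp
  have "\<not> (q = p \<and> i < d \<and> i \<noteq> 0)"
  proof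
    assume "q = p \<and> i < d \<and> i \<noteq> 0"
    then have "\<pi> (q, i) \<in> \<pi> ` ({p} \<times> {1..<d})" by auto
    then show False using leaves_image[OF assms(1,3)] \<pi> by auto
  qed
  then show ?thesis using r qi \<pi> that by (auto simp: gadget_rel_iff)
qed

lemma local_perm_permutes:
  assumes "p \<in> P"
  shows "local_perm d \<pi> p permutes {..<d}"
proof (rule bij_imp_permutes)
  have *: "\<pi> (p, i) = (p, local_perm d \<pi> p i)" if "i < d" "i \<noteq> 0 \<or> \<not> leaves \<pi> p" for i
    by (rule matched_inside[OF assms that]) (simp add: local_perm_def that)
  have "inj_on (local_perm d \<pi> p) {..<d}"
  proof (cases "leaves \<pi> p")
    case False
    show ?thesis
    proof (rule inj_onI)
      fix i j assume "i \<in> {..<d}" "j \<in> {..<d}" "local_perm d \<pi> p i = local_perm d \<pi> p j"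
      then have "\<pi> (p, i) = \<pi> (p, j)" using *[of i] *[of j] False by simp
      then show "i = j" using injD[OF permutes_inj[OF perm]] by blast
    qed
  next
    case True
    have "local_perm d \<pi> p i \<noteq> 0" if "i \<noteq> 0" "i < d" for i
    proof -
      have "\<pi> (p, i) \<in> \<pi> ` ({p} \<times> {1..<d})" using that by auto
      then show ?thesis using leaves_image[OF assms True] *[of i] that by auto
    qed
    moreover have "local_perm d \<pi> p 0 = 0" using True by (simp add: local_perm_def leaves_def)
    moreover have "i = j" if "i \<noteq> 0" "j \<noteq> 0" "i < d" "j < d" "local_perm d \<pi> p i = local_perm d \<pi> p j"
      for i j
    proof -
      have "\<pi> (p, i) = \<pi> (p, j)" using *[of i] *[of j] that by simp
      then show ?thesis using injD[OF permutes_inj[OF perm]] by blast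
    qed
    ultimately show ?thesis unfolding inj_on_def by (metis lessThan_iff)
  qed
  moreover have im: "local_perm d \<pi> p ` {..<d} \<subseteq> {..<d}"
  proof (rule image_subsetI)
    fix i assume i: "i \<in> {..<d}"
    show "local_perm d \<pi> p i \<in> {..<d}"
    proof (cases "i \<noteq> 0 \<or> \<not> leaves \<pi> p")
      case True
      show ?thesis by (rule matched_inside[OF assms _ True]) (use i in \<open>simp_all add: local_perm_def\<close>)
    next
      case False
      then show ?thesis using i by (simp add: local_perm_def leaves_def)
    qed
  qed
  ultimately show "bij_betw (local_perm d \<pi> p) {..<d} {..<d}"
    using endo_inj_surj[OF _ im] by (simp add: bij_betw_def)
qed (simp add: local_perm_def)

text \<open>The edge from \<open>0\<close> to \<open>0\<close> is missing in the gadget, so a fixed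
  \<open>0\<close> can only be the default value and records that the link is used.\<close>

lemma local_perm_zero:
  assumes "p \<in> P" "0 < d"
  shows "local_perm d \<pi> p 0 = 0 \<longleftrightarrow> leaves \<pi> p"
proof (cases "leaves \<pi> p")
  case False
  obtain j where "\<pi> (p, 0) = (p, j)" "j \<noteq> 0" using matched_inside[OF assms] False by blast
  then show ?thesis using assms False by (simp add: local_perm_def)
qed (simp add: local_perm_def leaves_def)

lemma local_perm_inside:
  assumes "p \<in> P" "i < d" "i \<noteq> 0 \<or> local_perm d \<pi> p 0 \<noteq> 0"
  shows "\<pi> (p, i) = (p, local_perm d \<pi> p i)"
proof -
  have "i \<noteq> 0 \<or> \<not> leaves \<pi> p" using local_perm_zero[OF assms(1)] assms(2,3) by auto
  from matched_inside[OF assms(1,2) this] show ?thesis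
    by (metis assms(2) fst_conv local_perm_def snd_conv)
qed

end

text \<open>The local permutations reveal which gadgets leave. A leaving gadget has only one link to
  follow. A hub \<open>q\<close> is matched to some gadget \<open>p\<close>, as hubs are not linked
  to each other; then \<open>p\<close> leaves under both permutations, and the only link into
  \<open>p\<close> comes from \<open>q\<close>, so both send \<open>(q, 0)\<close> to
  \<open>(p, 0)\<close>.\<close>

lemma local_perm_inj:
  assumes P: "P \<inter> Q = {}" "0 < d" "\<And>p. (p, p) \<notin> N" "N \<subseteq> (P \<union> Q) \<times> (P \<union> Q)" "N \<inter> (Q \<times> Q) = {}"
    and N: "\<And>p. p \<in> P \<Longrightarrow> \<exists>q. N `` {p} = {q}" "\<And>p. p \<in> P \<Longrightarrow> \<exists>q. N\<inverse> `` {p} = {q}"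
    and \<pi>: "\<pi> permutes gadget_verts d P Q"
      "\<And>a. a \<in> gadget_verts d P Q \<Longrightarrow> (a, \<pi> a) \<in> gadget_rel d P N"
    and \<rho>: "\<rho> permutes gadget_verts d P Q"
      "\<And>a. a \<in> gadget_verts d P Q \<Longrightarrow> (a, \<rho> a) \<in> gadget_rel d P N"
    and eq: "\<And>p. p \<in> P \<Longrightarrow> local_perm d \<pi> p = local_perm d \<rho> p"
  shows "\<pi> = \<rho>"
proof
  fix a
  have leaves: "leaves \<pi> p \<longleftrightarrow> leaves \<rho> p" if "p \<in> P" for p
    using local_perm_zero[OF P(3) \<pi> that P(2)] local_perm_zero[OF P(3) \<rho> that P(2)] eq[OF that] by simp
  show "\<pi> a = \<rho> a"
  proof (cases "a \<in> gadget_verts d P Q")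
    case False
    then show ?thesis using \<pi>(1) \<rho>(1) by (simp add: permutes_not_in)
  next
    case True
    then consider p i where "a = (p, i)" "p \<in> P" "i < d" "i \<noteq> 0 \<or> \<not> leaves \<pi> p"
      | p where "a = (p, 0)" "p \<in> P" "leaves \<pi> p"
      | q where "a = (q, 0)" "q \<in> Q"
      unfolding gadget_verts_def by blast
    then show ?thesis
    proof cases
      case 1
      then have c: "i \<noteq> 0 \<or> local_perm d \<pi> p 0 \<noteq> 0"
        using local_perm_zero[OF P(3) \<pi> 1(2) P(2)] by simp
      show ?thesis
        using local_perm_inside[OF P(3) \<pi> 1(2,3) c] eq[OF 1(2)]
          local_perm_inside[OF P(3) \<rho> 1(2,3) c[unfolded eq[OF 1(2)]]] 1(1)
        by simp
    next
      case 2
      obtain q where q: "N `` {p} = {q}" using N(1)[OF 2(2)] by blast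
      obtain q1 where "\<pi> (p, 0) = (q1, 0)" "(p, q1) \<in> N"
        using leaves_link[OF P(3) \<pi> 2(2) P(2) 2(3)] .
      moreover obtain q2 where "\<rho> (p, 0) = (q2, 0)" "(p, q2) \<in> N"
        using leaves_link[OF P(3) \<rho> 2(2) P(2)] leaves[OF 2(2)] 2(3) by blast
      moreover have "q' = q" if "(p, q') \<in> N" for q' using q that by blast
      ultimately show ?thesis using 2(1) by metis
    next
      case 3
      have "(a, \<pi> a) \<in> gadget_rel d P N" using \<pi>(2) True .
      then obtain p where p: "\<pi> a = (p, 0)" "(q, p) \<in> N"
        using 3 P(1) by (cases "\<pi> a") (auto simp: gadget_rel_iff)
      then have pP: "p \<in> P" using P(4,5) 3 by auto
      have "leaves \<pi> p" using leaves_target[OF P(3) \<pi> pP P(2) p(2)] p(1) 3(1) by simp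
      then have "leaves \<rho> p" using leaves pP by simp
      then obtain q' where q': "(q', p) \<in> N" "\<rho> (q', 0) = (p, 0)"
        using leaves_source[OF P(3) \<rho> pP P(2)] by blast
      obtain q0 where q0: "N\<inverse> `` {p} = {q0}" using N(2)[OF pP] by blast
      have "q' \<in> {q0}" "q \<in> {q0}" unfolding q0[symmetric] using q'(1) p(2) by blast+
      then have "q' = q" by simp
      then show ?thesis using q'(2) p(1) 3(1) by simp
    qed
  qed
qed

section \<open>Theta graphs and cycles\<close>

text \<open>The gadgets \<open>c * L, \<dots>, c * L + L - 1\<close> form the \<open>c\<close>-th of \<open>d\<close> chains, and \<open>- 1\<close> is the hub
  at which all chains start and end.\<close>

definition theta_links :: "nat \<Rightarrow> nat \<Rightarrow> (int \<times> int) set" where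
  "theta_links d L =
     {(p, q). p \<in> {0..<int (d * L)} \<and> q = (if int L dvd p then - 1 else p - 1)} \<union>
     {(p, q). p = - 1 \<and> q \<in> {0..<int (d * L)} \<and> int L dvd q + 1}"

definition theta_graph :: "nat \<Rightarrow> nat \<Rightarrow> nat graph" where
  "theta_graph d L = bip_graph (gadget_verts d {0..<int (d * L)} {- 1})
     (gadget_rel d {0..<int (d * L)} (theta_links d L))"

definition cycle_links :: "nat \<Rightarrow> (int \<times> int) set" where
  "cycle_links n = {(p, q). p \<in> {0..<int n} \<and> q = (p - 1) mod int n}"

definition cycle_graph :: "nat \<Rightarrow> nat \<Rightarrow> nat graph" where
  "cycle_graph d n = bip_graph (gadget_verts d {0..<int n} {}) (gadget_rel d {0..<int n} (cycle_links n))"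

section \<open>Sizes, degrees and matchings of cycles and theta graphs\<close>

lemma finite_gadget_verts: "finite P \<Longrightarrow> finite Q \<Longrightarrow> finite (gadget_verts d P Q)"
  by (simp add: gadget_verts_def)

lemma card_verts_cycle: "card (verts (cycle_graph d n)) = 2 * (d * n)"
  by (simp add: cycle_graph_def card_verts_bip_graph gadget_verts_def card_cartesian_product)

lemma card_verts_theta: "card (verts (theta_graph d L)) = 2 * (d * (d * L)) + 2"
proof -
  have "card ({0..<int (d * L)} \<times> {..<d} \<union> {- 1} \<times> {0::nat}) = d * (d * L) + 1"
    by (subst card_Un_disjoint) (auto simp: card_cartesian_product simp flip: of_nat_mult)
  then show ?thesis by (simp add: theta_graph_def card_verts_bip_graph gadget_verts_def)
qed

lemma cycle_links_Image:
  assumes "p \<in> {0..<int n}"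
  shows "cycle_links n `` {p} = {(p - 1) mod int n}" "(cycle_links n)\<inverse> `` {p} = {(p + 1) mod int n}"
proof -
  show "cycle_links n `` {p} = {(p - 1) mod int n}" using assms by (auto simp: cycle_links_def)
  have "p = (q - 1) mod int n \<longleftrightarrow> q = (p + 1) mod int n" if "q \<in> {0..<int n}" for q
  proof
    assume "p = (q - 1) mod int n"
    then have "(p + 1) mod int n = (q - 1 + 1) mod int n" by (simp only: mod_add_left_eq)
    then show "q = (p + 1) mod int n" using that by simp
  next
    assume "q = (p + 1) mod int n"
    then have "(q - 1) mod int n = (p + 1 - 1) mod int n" by (simp only: mod_diff_left_eq)
    then show "p = (q - 1) mod int n" using assms by simp
  qed
  moreover have "(p + 1) mod int n \<in> {0..<int n}" using assms by simp
  ultimately show "(cycle_links n)\<inverse> `` {p} = {(p + 1) mod int n}"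
    unfolding cycle_links_def by blast
qed

lemma cycle_graph_regular_bipartite:
  assumes "0 < d" "0 < n"
  shows "cycle_graph d n \<in> regular_bipartite_graphs d"
proof -
  let ?P = "{0..<int n}"
  have sub: "cycle_links n \<subseteq> (?P \<union> {}) \<times> (?P \<union> {})" using assms by (auto simp: cycle_links_def)
  note R = gadget_rel_subset[OF assms(1) sub]
  have "(0, 0) \<in> gadget_verts d ?P {}" using assms by (simp add: gadget_verts_def)
  then have "fin_simple_graph (cycle_graph d n)"
    unfolding cycle_graph_def by (intro fin_simple_bip_graph R finite_gadget_verts) auto
  moreover have "regular d (cycle_graph d n)"
    unfolding cycle_graph_def by (intro regular_gadget) (simp_all add: cycle_links_Image)
  moreover have "bipartite (cycle_graph d n)"
    unfolding cycle_graph_def by (rule bipartite_bip_graph[OF R])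
  ultimately show ?thesis by (simp add: regular_bipartite_graphs_def)
qed

lemma pm_cycle_lower:
  assumes "0 < d" "0 < n"
  shows "n_in d ^ n \<le> pm (cycle_graph d n)"
proof -
  have "cycle_links n \<subseteq> {0..<int n} \<times> {0..<int n}" using assms by (auto simp: cycle_links_def)
  from pm_gadget_lower[OF _ assms(1) this] show ?thesis by (simp add: cycle_graph_def)
qed

lemma theta_links_iff:
  "(p, q) \<in> theta_links d L \<longleftrightarrow>
     p \<in> {0..<int (d * L)} \<and> q = (if int L dvd p then - 1 else p - 1) \<or>
     p = - 1 \<and> q \<in> {0..<int (d * L)} \<and> int L dvd q + 1"
  by (auto simp: theta_links_def)

lemma theta_links_Image:
  assumes "p \<in> {0..<int (d * L)}"
  shows "theta_links d L `` {p} = {if int L dvd p then - 1 else p - 1}"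
    "(theta_links d L)\<inverse> `` {p} = {if int L dvd p + 1 then - 1 else p + 1}"
proof -
  show "theta_links d L `` {p} = {if int L dvd p then - 1 else p - 1}"
    using assms by (auto simp: theta_links_iff)
  have "p + 1 \<noteq> int (d * L)" if "\<not> int L dvd p + 1" using that by auto
  then have "p + 1 \<in> {0..<int (d * L)}" if "\<not> int L dvd p + 1" using assms that by auto
  then show "(theta_links d L)\<inverse> `` {p} = {if int L dvd p + 1 then - 1 else p + 1}"
    using assms by (auto simp: theta_links_iff split: if_splits)
qed

lemma theta_links_subset:
  assumes "0 < L"
  shows "theta_links d L \<subseteq> ({0..<int (d * L)} \<union> {- 1}) \<times> ({0..<int (d * L)} \<union> {- 1})"
proof (rule subrelI)
  fix p q assume "(p, q) \<in> theta_links d L"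
  moreover have "p \<noteq> 0" if "\<not> int L dvd p" using that by auto
  ultimately show "(p, q) \<in> ({0..<int (d * L)} \<union> {- 1}) \<times> ({0..<int (d * L)} \<union> {- 1})"
    by (auto simp: theta_links_iff split: if_splits)
qed

lemma card_theta_links_hub:
  assumes "0 < L"
  shows "card (theta_links d L `` {- 1}) = d" "card ((theta_links d L)\<inverse> `` {- 1}) = d"
proof -
  let ?f = "\<lambda>c. int c * int L" and ?P = "{0..<int (d * L)}"
  have *: "{q. 0 \<le> q \<and> q < int (d * L) \<and> int L dvd q} = ?f ` {..<d}"
  proof (intro subset_antisym subsetI)
    fix q assume "q \<in> {q. 0 \<le> q \<and> q < int (d * L) \<and> int L dvd q}"
    then have q: "0 \<le> q" "q < int (d * L)" "int L dvd q" by auto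
    then obtain k where k: "q = int L * k" by auto
    with q assms have "0 \<le> k" "k < int d" by (auto simp: zero_le_mult_iff mult.commute[of _ k])
    then show "q \<in> ?f ` {..<d}" using k by (intro image_eqI[of _ _ "nat k"]) auto
  next
    fix q assume "q \<in> ?f ` {..<d}"
    then obtain c where "q = ?f c" "c < d" by auto
    then show "q \<in> {q. 0 \<le> q \<and> q < int (d * L) \<and> int L dvd q}"
      using assms by (auto simp flip: of_nat_mult)
  qed
  have inj: "inj_on ?f {..<d}" using assms by (auto simp: inj_on_def)
  have "(theta_links d L)\<inverse> `` {- 1} = {q. 0 \<le> q \<and> q < int (d * L) \<and> int L dvd q}"
    by (auto simp: theta_links_iff split: if_splits)
  then show "card ((theta_links d L)\<inverse> `` {- 1}) = d" unfolding * by (simp add: card_image[OF inj])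
  \<comment> \<open>The hub links to the last gadget of each chain, which is the first one shifted
    by \<open>L - 1\<close>.\<close>
  have **: "theta_links d L `` {- 1} = (\<lambda>q. q + int L - 1) ` {q. 0 \<le> q \<and> q < int (d * L) \<and> int L dvd q}"
  proof (intro subset_antisym subsetI)
    fix q assume "q \<in> theta_links d L `` {- 1}"
    then have q: "0 \<le> q" "q < int (d * L)" "int L dvd q + 1" by (auto simp: theta_links_iff)
    then have "int L \<le> q + 1" by (intro zdvd_imp_le) auto
    then show "q \<in> (\<lambda>q. q + int L - 1) ` {q. 0 \<le> q \<and> q < int (d * L) \<and> int L dvd q}"
      using q assms by (intro image_eqI[of _ _ "q + 1 - int L"]) auto
  next
    fix q assume "q \<in> (\<lambda>q. q + int L - 1) ` {q. 0 \<le> q \<and> q < int (d * L) \<and> int L dvd q}"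
    then obtain c where c: "q = int c * int L + int L - 1" "c < d" unfolding * by auto
    have "int (Suc c * L) \<le> int (d * L)" using c(2) by (intro of_nat_mono mult_right_mono) auto
    then have "q < int (d * L)" using c(1) by (simp add: algebra_simps)
    moreover have "0 \<le> int c * int L" by simp
    then have "0 \<le> q" unfolding c(1) using assms by linarith
    ultimately show "q \<in> theta_links d L `` {- 1}" using c(1) by (auto simp: theta_links_iff)
  qed
  show "card (theta_links d L `` {- 1}) = d"
    unfolding ** * by (auto simp: card_image[OF inj] card_image inj_on_def)
qed

lemma theta_graph_regular_bipartite:
  assumes "0 < d" "0 < L"
  shows "theta_graph d L \<in> regular_bipartite_graphs d"
proof -
  let ?P = "{0..<int (d * L)}"
  note R = gadget_rel_subset[OF assms(1) theta_links_subset[OF assms(2), of d]]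
  have "(- 1, 0) \<in> gadget_verts d ?P {- 1}" by (simp add: gadget_verts_def)
  then have "fin_simple_graph (theta_graph d L)"
    unfolding theta_graph_def by (intro fin_simple_bip_graph R finite_gadget_verts) auto
  moreover have "regular d (theta_graph d L)"
    unfolding theta_graph_def
    by (intro regular_gadget) (auto simp: theta_links_Image card_theta_links_hub assms)
  moreover have "bipartite (theta_graph d L)"
    unfolding theta_graph_def by (rule bipartite_bip_graph[OF R])
  ultimately show ?thesis by (simp add: regular_bipartite_graphs_def)
qed

text \<open>The right vertex of the hub is matched to the first gadget of exactly one chain. Along a
  chain, using one link forces the use of the next, so precisely the gadgets of that chain leave;
  \<open>c\<close> is its number.\<close>

lemma theta_leaves:
  assumes "0 < d" "0 < L"
    and \<pi>: "\<pi> permutes gadget_verts d {0..<int (d * L)} {- 1}"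
      "\<And>a. a \<in> gadget_verts d {0..<int (d * L)} {- 1} \<Longrightarrow>
        (a, \<pi> a) \<in> gadget_rel d {0..<int (d * L)} (theta_links d L)"
  shows "\<exists>c<d. \<forall>p\<in>{0..<int (d * L)}. leaves \<pi> p \<longleftrightarrow> p div int L = int c"
proof -
  let ?P = "{0..<int (d * L)}" and ?T = "theta_links d L"
  have irrefl: "\<And>p. (p, p) \<notin> ?T" by (auto simp: theta_links_iff split: if_splits)
  \<comment> \<open>\<open>x\<close> will be the first gadget of the selected chain: only gadgets at
    multiples of \<open>L\<close> link to the hub.\<close>
  obtain x y where xy: "inv \<pi> (- 1, 0) = (x, y)" by fastforce
  have hub: "(- 1, 0) \<in> gadget_verts d ?P {- 1}" by (simp add: gadget_verts_def)
  have \<pi>x: "\<pi> (x, y) = (- 1, 0)" using permutes_inverses(1)[OF \<pi>(1), of "(- 1, 0)"] xy by simp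
  have "(x, y) \<in> gadget_verts d ?P {- 1}"
    using permutes_in_image[OF permutes_inv[OF \<pi>(1)]] hub xy by metis
  from \<pi>(2)[OF this] have x: "x \<in> ?P" "int L dvd x" "y = 0"
    unfolding \<pi>x by (auto simp: gadget_rel_iff theta_links_iff split: if_splits)
  have start: "leaves \<pi> p \<longleftrightarrow> p = x" if p: "p \<in> ?P" "int L dvd p" for p
  proof
    assume "leaves \<pi> p"
    then obtain q where q: "\<pi> (p, 0) = (q, 0)" "(p, q) \<in> ?T"
      using leaves_link[OF irrefl \<pi> p(1) assms(1)] by blast
    then have "q = - 1" using p by (auto simp: theta_links_iff)
    then have "\<pi> (p, 0) = \<pi> (x, y)" using q \<pi>x by simp
    then show "p = x" using injD[OF permutes_inj[OF \<pi>(1)]] by blast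
  next
    assume "p = x" then show "leaves \<pi> p" using \<pi>x x by (auto simp: leaves_def)
  qed
  \<comment> \<open>Links lead from \<open>p + 1\<close> down to \<open>p\<close>. If
    \<open>p + 1\<close> leaves, it occupies the right vertex \<open>(p, 0)\<close>; if
    \<open>p\<close> leaves, that vertex must be matched from \<open>p + 1\<close>.\<close>
  have succ: "leaves \<pi> (p + 1) \<longleftrightarrow> leaves \<pi> p"
    if p: "p \<in> ?P" "p + 1 \<in> ?P" "\<not> int L dvd p + 1" for p
  proof
    assume "leaves \<pi> (p + 1)"
    then obtain q where q: "\<pi> (p + 1, 0) = (q, 0)" "(p + 1, q) \<in> ?T"
      using leaves_link[OF irrefl \<pi> p(2) assms(1)] by blast
    then have "q = p" using p by (auto simp: theta_links_iff)
    then show "leaves \<pi> p" using leaves_target[OF irrefl \<pi> p(1) assms(1)] q by simp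
  next
    assume "leaves \<pi> p"
    then obtain q where q: "\<pi> (q, 0) = (p, 0)" "(q, p) \<in> ?T"
      using leaves_source[OF irrefl \<pi> p(1) assms(1)] by blast
    then have "q = p + 1" using p by (auto simp: theta_links_iff split: if_splits)
    then show "leaves \<pi> (p + 1)" using q by (simp add: leaves_def)
  qed
  have shift: "b + int k \<in> ?P \<Longrightarrow> k < L \<Longrightarrow> leaves \<pi> (b + int k) \<longleftrightarrow> leaves \<pi> b"
    if b: "0 \<le> b" "int L dvd b" for b k
  proof (induction k)
    case (Suc k)
    have "\<not> int L dvd int (Suc k)" using Suc.prems(2) by (auto dest: zdvd_imp_le)
    then have "\<not> int L dvd b + int k + 1" using b(2) dvd_add_right_iff[of "int L" b "int (Suc k)"]
      by (simp add: add_ac)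
    moreover have "b + int k \<in> ?P" "b + int k + 1 \<in> ?P" using Suc.prems b(1) by auto
    ultimately show ?case using succ[of "b + int k"] Suc.IH Suc.prems(2) by (simp add: add_ac)
  qed simp
  have "leaves \<pi> p \<longleftrightarrow> p div int L = x div int L" if p: "p \<in> ?P" for p
  proof -
    \<comment> \<open>\<open>b\<close> is the first gadget of the chain containing \<open>p\<close>;
      \<open>shift\<close> carries the claim from \<open>b\<close> to \<open>p\<close>.\<close>
    define b where "b = int L * (p div int L)"
    have pb: "p = b + int (nat (p mod int L))" unfolding b_def using assms(2) by simp
    have b: "0 \<le> b" "int L dvd b" using p assms(2) by (auto simp: b_def pos_imp_zdiv_nonneg_iff)
    have "b \<le> p" using pb by linarith
    then have "b \<in> ?P" using p b(1) by auto
    have "nat (p mod int L) < L" using assms(2) by (simp add: nat_less_iff)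
    then have "leaves \<pi> p \<longleftrightarrow> leaves \<pi> b" using shift[OF b, of "nat (p mod int L)"] p pb by simp
    also have "\<dots> \<longleftrightarrow> b = x" using start[OF \<open>b \<in> ?P\<close> b(2)] .
    also have "\<dots> \<longleftrightarrow> p div int L = x div int L" using x(2) assms(2) by (auto simp: b_def)
    finally show ?thesis .
  qed
  moreover have "0 \<le> x div int L" using x assms(2) by (simp add: pos_imp_zdiv_nonneg_iff)
  moreover have "x div int L < int d" 
  proof -
    have "int L * (x div int L) < int L * int d" using x by (simp add: mult.commute)
    then show ?thesis using assms(2) by simp
  qed
  ultimately show ?thesis by (intro exI[of _ "nat (x div int L)"]) (simp add: nat_less_iff)
qed

text \<open>A matching is encoded by its family of local permutations. If \<open>c\<close> is the
  chain in use, its \<open>L\<close> gadgets offer \<open>n_out d\<close> choices each and the other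
  \<open>(d - 1) * L\<close> gadgets offer \<open>n_in d\<close> each. Taking the union over
  \<open>c\<close> gives the factor \<open>d\<close>.\<close>

lemma pm_theta_upper:
  assumes "0 < d" "0 < L"
  shows "pm (theta_graph d L) \<le> d * (n_out d ^ L * n_in d ^ ((d - 1) * L))"
proof -
  let ?P = "{0..<int (d * L)}" and ?T = "theta_links d L"
  let ?V = "gadget_verts d ?P {- 1}"
  let ?Y = "{\<pi>. \<pi> permutes ?V \<and> (\<forall>a\<in>?V. (a, \<pi> a) \<in> gadget_rel d ?P ?T)}"
  let ?O = "{\<sigma>. \<sigma> permutes {..<d} \<and> \<sigma> 0 = 0}" and ?I = "{\<sigma>. \<sigma> permutes {..<d} \<and> \<sigma> 0 \<noteq> 0}"
  define X where "X c p = (if p div int L = int c then ?O else ?I)" for c :: nat and p :: int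
  define F where "F \<pi> = restrict (local_perm d \<pi>) ?P" for \<pi> :: "int \<times> nat \<Rightarrow> int \<times> nat"
  have irrefl: "\<And>p. (p, p) \<notin> ?T" by (auto simp: theta_links_iff split: if_splits)
  have "F \<pi> \<in> (\<Union>c<d. Pi\<^sub>E ?P (X c))" if "\<pi> \<in> ?Y" for \<pi>
  proof -
    from that have \<pi>: "\<pi> permutes ?V" "\<And>a. a \<in> ?V \<Longrightarrow> (a, \<pi> a) \<in> gadget_rel d ?P ?T" by auto
    from theta_leaves[OF assms \<pi>] obtain c where
      c: "c < d" "\<And>p. p \<in> ?P \<Longrightarrow> leaves \<pi> p \<longleftrightarrow> p div int L = int c" by blast
    have "local_perm d \<pi> p \<in> X c p" if "p \<in> ?P" for p
      using local_perm_permutes[OF irrefl \<pi> that] local_perm_zero[OF irrefl \<pi> that assms(1)] c(2)[OF that]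
      by (cases "p div int L = int c") (simp_all add: X_def)
    then have "F \<pi> \<in> Pi\<^sub>E ?P (X c)" unfolding F_def PiE_iff by simp
    then show ?thesis using c(1) by blast
  qed
  moreover have "inj_on F ?Y"
  proof (rule inj_onI)
    fix \<pi> \<rho> assume \<pi>\<rho>: "\<pi> \<in> ?Y" "\<rho> \<in> ?Y" "F \<pi> = F \<rho>"
    then have \<pi>: "\<pi> permutes ?V" "\<And>a. a \<in> ?V \<Longrightarrow> (a, \<pi> a) \<in> gadget_rel d ?P ?T"
      and \<rho>: "\<rho> permutes ?V" "\<And>a. a \<in> ?V \<Longrightarrow> (a, \<rho> a) \<in> gadget_rel d ?P ?T" by auto
    show "\<pi> = \<rho>"
    proof (rule local_perm_inj[OF _ assms(1) irrefl theta_links_subset[OF assms(2)] _ _ _ \<pi> \<rho>])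
      show "?T \<inter> {- 1} \<times> {- 1} = {}" by (auto simp: theta_links_iff)
      show "local_perm d \<pi> p = local_perm d \<rho> p" if "p \<in> ?P" for p
        using fun_cong[OF \<pi>\<rho>(3), of p] that by (simp add: F_def)
    qed (simp_all add: theta_links_Image)
  qed
  moreover have "finite (X c p)" for c p
    using finite_permutations[of "{..<d}"] by (simp add: X_def)
  then have "finite (\<Union>c<d. Pi\<^sub>E ?P (X c))" by (simp add: finite_PiE)
  ultimately have "card ?Y \<le> card (\<Union>c<d. Pi\<^sub>E ?P (X c))" by (intro card_inj_on_le[of F]) auto
  also have "\<dots> \<le> (\<Sum>c<d. card (Pi\<^sub>E ?P (X c)))" by (rule card_UN_le) simp
  also have "card (Pi\<^sub>E ?P (X c)) = n_out d ^ L * n_in d ^ ((d - 1) * L)" if "c < d" for c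
  proof -
    have "Suc c * L \<le> d * L" using that by (intro mult_right_mono) auto
    then have le: "int c * int L + int L \<le> int (d * L)" by (simp flip: of_nat_mult of_nat_add add: add.commute)
    have div_iff: "p div int L = int c \<longleftrightarrow> int c * int L \<le> p \<and> p < int c * int L + int L" for p
    proof
      assume "p div int L = int c"
      then have "p = int c * int L + p mod int L" by (metis div_mult_mod_eq)
      moreover have "0 \<le> p mod int L" "p mod int L < int L" using assms(2) by auto
      ultimately show "int c * int L \<le> p \<and> p < int c * int L + int L" by linarith
    next
      assume "int c * int L \<le> p \<and> p < int c * int L + int L"
      then show "p div int L = int c"
        by (intro int_div_pos_eq[of _ _ _ "p - int c * int L"]) (auto simp: mult.commute)
    qed
    have ge: "0 \<le> int c * int L" by simp
    from le have "?P \<inter> {p. p div int L = int c} = {int c * int L..<int c * int L + int L}"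
      unfolding div_iff by (auto simp del: of_nat_mult intro: order_trans[OF ge])
    then have c1: "card (?P \<inter> {p. p div int L = int c}) = L" by simp
    have "?P \<inter> - {p. p div int L = int c} = ?P - (?P \<inter> {p. p div int L = int c})" by blast
    then have "card (?P \<inter> - {p. p div int L = int c}) = d * L - L"
      by (simp add: card_Diff_subset c1 del: of_nat_mult)
    then have c2: "card (?P \<inter> - {p. p div int L = int c}) = (d - 1) * L" by (simp add: diff_mult_distrib)
    have "card (Pi\<^sub>E ?P (X c)) = (\<Prod>p\<in>?P. if p div int L = int c then n_out d else n_in d)"
      by (subst card_PiE) (auto simp: X_def n_out_def n_in_def intro!: prod.cong)
    then show ?thesis by (simp add: prod.If_cases c1 c2 del: of_nat_mult)
  qed
  then have "(\<Sum>c<d. card (Pi\<^sub>E ?P (X c))) = d * (n_out d ^ L * n_in d ^ ((d - 1) * L))" by simp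
  finally show ?thesis
    unfolding theta_graph_def
    by (simp only: pm_bip_graph[OF finite_gadget_verts[of ?P "{- 1}"]
          gadget_rel_subset[OF assms(1) theta_links_subset[OF assms(2)]]]
        finite_atLeastLessThan_int finite.intros)
qed

section \<open>Local convergence\<close>

text \<open>The common local limit of both families: a chain infinite in both directions, without
  hubs. Only its balls matter.\<close>

definition chain_graph :: "nat \<Rightarrow> nat graph" where
  "chain_graph d = bip_graph (gadget_verts d (UNIV :: int set) {}) (gadget_rel d UNIV {(p, q). q = p - 1})"

text \<open>Translation by \<open>p\<close> is a local isomorphism from the infinite chain as long
  as the walk stays among positions whose links look like those of the chain.\<close>

lemma rooted_iso_chain_ball:
  fixes P Q :: "int set"
  assumes i: "i < d"
    and P: "\<And>k. \<bar>k\<bar> \<le> int r \<Longrightarrow> p + k \<in> P"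
    and pred: "\<And>k. \<bar>k\<bar> \<le> int r \<Longrightarrow> N `` {p + k} = {p + k - 1}"
    and succ: "\<And>k. \<bar>k\<bar> \<le> int r \<Longrightarrow> N\<inverse> `` {p + k} = {p + k + 1}"
  shows "rooted_iso (rooted_ball (chain_graph d) (to_nat ((0 :: int, i), s :: bool)) r)
    (rooted_ball (bip_graph (gadget_verts d P Q) (gadget_rel d P N)) (to_nat ((p, i), s)) r)"
proof -
  let ?G = "bip_graph (gadget_verts d P Q) (gadget_rel d P N)" and ?H = "chain_graph d"
  define f where "f v = (case from_nat v of ((j, l), t) \<Rightarrow> to_nat ((p + j :: int, l :: nat), t :: bool))" for v
  have f: "f (to_nat ((j, l), t)) = to_nat ((p + j, l), t)" for j and l :: nat and t :: bool
    by (simp add: f_def)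
  \<comment> \<open>An edge changes the position by at most one, so \<open>k\<close> steps from
    position \<open>0\<close> stay within distance \<open>k\<close>.\<close>
  define S where "S k = {to_nat ((j, l), t) | (j :: int) l (t :: bool). \<bar>j\<bar> \<le> int k \<and> l < d}" for k
  have adjH: "(to_nat ((j, l), t), w) \<in> adj_rel ?H \<longleftrightarrow>
      (\<exists>q m. w = to_nat ((q, m), \<not> t) \<and> (q = j \<and> l < d \<and> m < d \<and> (l \<noteq> 0 \<or> m \<noteq> 0) \<or>
        l = 0 \<and> m = 0 \<and> q = (if t then j + 1 else j - 1)))" for j :: int and l w and t :: bool
    unfolding chain_graph_def adj_bip_graph by (cases t) (auto simp: gadget_rel_iff)
  have adjG: "(to_nat ((p + j, l), t), w) \<in> adj_rel ?G \<longleftrightarrow>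
      (\<exists>q m. w = to_nat ((p + q, m), \<not> t) \<and> (q = j \<and> l < d \<and> m < d \<and> (l \<noteq> 0 \<or> m \<noteq> 0) \<or>
        l = 0 \<and> m = 0 \<and> q = (if t then j + 1 else j - 1)))"
    if j: "\<bar>j\<bar> \<le> int r" for j l w and t :: bool
  proof -
    have N: "(p + j, q) \<in> N \<longleftrightarrow> q = p + j - 1" "(q, p + j) \<in> N \<longleftrightarrow> q = p + j + 1" for q
      using pred[OF j] succ[OF j] by blast+
    have sh: "(\<exists>b. Z b) \<longleftrightarrow> (\<exists>q m. Z (p + q, m))" for Z :: "int \<times> nat \<Rightarrow> bool"
    proof
      assume "\<exists>b. Z b"
      then obtain q m where "Z (q, m)" by auto
      then have "Z (p + (q - p), m)" by simp
      then show "\<exists>q m. Z (p + q, m)" by blast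
    qed auto
    show ?thesis
      unfolding adj_bip_graph sh using P[OF j]
      by (cases t) (auto simp: gadget_rel_iff N)
  qed
  have "rooted_iso (rooted_ball ?H (to_nat ((0 :: int, i), s)) r) (rooted_ball ?G (f (to_nat ((0 :: int, i), s))) r)"
  proof (rule rooted_iso_ball[where S = S and f = f])
    show "to_nat ((0 :: int, i), s) \<in> S 0" using i by (auto simp: S_def)
    show "v \<in> verts ?H \<and> f v \<in> verts ?G" if k: "k \<le> r" and v: "v \<in> S k" for k v
    proof -
      from v obtain j :: int and l and t :: bool where v: "v = to_nat ((j, l), t)" "\<bar>j\<bar> \<le> int k" "l < d" by (auto simp: S_def)
      then have "p + j \<in> P" using P k by simp
      then show ?thesis using v(3)
        unfolding v(1) f chain_graph_def verts_bip_graph by (simp add: gadget_verts_def)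
    qed
    show "w \<in> S (Suc k)" if "k \<le> r" and v: "v \<in> S k" and e: "(v, w) \<in> adj_rel ?H" for k v w
    proof -
      from v obtain j :: int and l and t :: bool where v: "v = to_nat ((j, l), t)" "\<bar>j\<bar> \<le> int k" "l < d" by (auto simp: S_def)
      from e[unfolded v(1) adjH] obtain q m where "w = to_nat ((q, m), \<not> t)" "m < d" "\<bar>q\<bar> \<le> int (Suc k)"
        using v(2) i by (auto split: if_splits)
      then show ?thesis by (auto simp: S_def)
    qed
    show "adj_rel ?G `` {f v} = f ` (adj_rel ?H `` {v})" if k: "k \<le> r" and v: "v \<in> S k" for k v
    proof -
      from v obtain j :: int and l and t :: bool where v: "v = to_nat ((j, l), t)" "\<bar>j\<bar> \<le> int k" "l < d" by (auto simp: S_def)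
      then have j: "\<bar>j\<bar> \<le> int r" using k by simp
      show ?thesis
      proof (intro subset_antisym subsetI)
        fix w assume "w \<in> adj_rel ?G `` {f v}"
        then have "(to_nat ((p + j, l), t), w) \<in> adj_rel ?G" by (simp add: v(1) f)
        from this[unfolded adjG[OF j]] obtain q m where w: "w = to_nat ((p + q, m), \<not> t)"
          and c: "q = j \<and> l < d \<and> m < d \<and> (l \<noteq> 0 \<or> m \<noteq> 0) \<or>
            l = 0 \<and> m = 0 \<and> q = (if t then j + 1 else j - 1)"
          by (elim exE conjE) (rule that)
        have "(v, to_nat ((q, m), \<not> t)) \<in> adj_rel ?H"
          unfolding v(1) adjH using c by (intro exI[of _ q] exI[of _ m] conjI refl)
        moreover have "w = f (to_nat ((q, m), \<not> t))" by (simp add: w f)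
        ultimately show "w \<in> f ` (adj_rel ?H `` {v})" by blast
      next
        fix w assume "w \<in> f ` (adj_rel ?H `` {v})"
        then obtain w' where w': "w = f w'" "(v, w') \<in> adj_rel ?H" by auto
        from w'(2)[unfolded v(1) adjH] have "(to_nat ((p + j, l), t), w) \<in> adj_rel ?G"
          unfolding adjG[OF j] w'(1) by (auto simp: f)
        then show "w \<in> adj_rel ?G `` {f v}" by (simp add: v(1) f)
      qed
    qed
    show "inj_on f (\<Union>k. S k)"
    proof (rule inj_onI)
      fix x y assume "x \<in> (\<Union>k. S k)" "y \<in> (\<Union>k. S k)" and eq: "f x = f y"
      then obtain j j' :: int and l l' :: nat and t t' :: bool where "x = to_nat ((j, l), t)" "y = to_nat ((j', l'), t')"
        unfolding S_def by blast
      then show "x = y" using eq by (simp add: f)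
    qed
  qed (auto simp: chain_graph_def card_edge_bip_graph)
  then show ?thesis by (simp add: f)
qed

text \<open>All gadgets of the infinite chain look alike, so its statistics are read off from the
  \<open>2 * d\<close> vertices at position \<open>0\<close>; dividing by \<open>2 * d\<close> gives
  the limiting ball probability.\<close>

definition chain_count :: "nat \<Rightarrow> nat rooted_graph \<Rightarrow> nat \<Rightarrow> nat" where
  "chain_count d \<alpha> r = card {(i, s). i < d \<and>
     rooted_iso (rooted_ball (chain_graph d) (to_nat ((0 :: int, i), s :: bool)) r) \<alpha>}"

text \<open>Over the good positions the share of vertices with ball \<open>\<alpha>\<close> is
  exactly that of the infinite chain. The remaining vertices shift the probability by at most their
  own proportion.\<close>

lemma ball_prob_estimate:
  fixes P Q :: "int set"
  assumes fin: "finite P" "finite Q" and d: "0 < d" and good: "good \<subseteq> P" and nonempty: "P \<noteq> {}"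
    and P: "\<And>p k. p \<in> good \<Longrightarrow> \<bar>k\<bar> \<le> int r \<Longrightarrow> p + k \<in> P"
    and pred: "\<And>p k. p \<in> good \<Longrightarrow> \<bar>k\<bar> \<le> int r \<Longrightarrow> N `` {p + k} = {p + k - 1}"
    and succ: "\<And>p k. p \<in> good \<Longrightarrow> \<bar>k\<bar> \<le> int r \<Longrightarrow> N\<inverse> `` {p + k} = {p + k + 1}"
    and G: "G = bip_graph (gadget_verts d P Q) (gadget_rel d P N)"
  shows "\<bar>ball_prob G \<alpha> r - chain_count d \<alpha> r / (2 * real d)\<bar> \<le>
    (real (card (verts G)) - 2 * real d * card good) / card (verts G)"
proof -
  let ?H = "chain_graph d"
  define T where "T = {(i, s). i < d \<and> rooted_iso (rooted_ball ?H (to_nat ((0 :: int, i), s :: bool)) r) \<alpha>}"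
  define X where "X = {v. rooted_iso (rooted_ball G v r) \<alpha>}"
  define enc where "enc = (\<lambda>(p :: int, i :: nat, s :: bool). to_nat ((p, i), s))"
  define W where "W = enc ` (good \<times> {..<d} \<times> UNIV)"
  have fin_verts: "finite (verts G)" and ne: "verts G \<noteq> {}"
    using fin nonempty d by (auto simp: G bip_graph_def gadget_verts_def)
  have inj: "inj enc" by (auto simp: enc_def inj_def)
  have W: "W \<subseteq> verts G"
    using good by (auto simp: W_def G verts_bip_graph gadget_verts_def enc_def)
  have "T \<subseteq> {..<d} \<times> UNIV" by (auto simp: T_def)
  from card_mono[OF _ this] have t: "card T \<le> 2 * d" by (simp add: card_cartesian_product)
  have iso: "enc (p, i, s) \<in> X \<longleftrightarrow> (i, s) \<in> T" if "p \<in> good" "i < d" for p i s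
  proof -
    have *: "rooted_iso (rooted_ball ?H (to_nat ((0 :: int, i), s)) r) (rooted_ball G (enc (p, i, s)) r)"
      unfolding G enc_def prod.case using that(1)
      by (intro rooted_iso_chain_ball P pred succ that(2))
    have "rooted_iso (rooted_ball G (enc (p, i, s)) r) (rooted_ball ?H (to_nat ((0 :: int, i), s)) r)"
    proof (rule rooted_iso_sym[OF *])
      have "to_nat ((0 :: int, i), s) \<in> verts ?H"
        using that(2) unfolding chain_graph_def verts_bip_graph by (simp add: gadget_verts_def)
      then show "snd (rooted_ball ?H (to_nat ((0 :: int, i), s)) r)
          \<in> verts (fst (rooted_ball ?H (to_nat ((0 :: int, i), s)) r))"
        by (auto simp: rooted_ball_def induced_subgraph_def ball_verts_def intro!: exI[of _ 0])
      show "e \<subseteq> verts (fst (rooted_ball ?H (to_nat ((0 :: int, i), s)) r))"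
        if "e \<in> edges (fst (rooted_ball ?H (to_nat ((0 :: int, i), s)) r))" for e
        using that by (auto simp: rooted_ball_def induced_subgraph_def ball_verts_def)
    qed
    with * show ?thesis
      using that(2) rooted_iso_trans unfolding X_def T_def by blast
  qed
  have "W \<inter> X = enc ` (good \<times> T)"
  proof (intro subset_antisym subsetI)
    fix v assume v: "v \<in> W \<inter> X"
    then obtain p i s where "v = enc (p, i, s)" "p \<in> good" "i < d" by (auto simp: W_def)
    then show "v \<in> enc ` (good \<times> T)" using v iso by blast
  next
    fix v assume "v \<in> enc ` (good \<times> T)"
    then obtain p i s where v: "v = enc (p, i, s)" "p \<in> good" "(i, s) \<in> T" by auto
    then have "i < d" by (auto simp: T_def)
    then show "v \<in> W \<inter> X" using v iso by (auto simp: W_def)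
  qed
  then have cWX: "card (W \<inter> X) = card good * card T"
    by (simp add: card_image inj_on_subset[OF inj] card_cartesian_product)
  have cW: "card W = 2 * d * card good"
    by (simp add: W_def card_image inj_on_subset[OF inj] card_cartesian_product)
  let ?V = "real (card (verts G))" and ?x = "real (card (verts G \<inter> X))"
  have Vpos: "0 < ?V" using fin_verts ne by (simp add: card_gt_0_iff)
  have prob: "ball_prob G \<alpha> r = ?x / ?V"
    by (simp add: ball_prob_def X_def measure_pmf_of_set[OF ne fin_verts])
  have "card (W \<inter> X) \<le> card (verts G \<inter> X)"
    using W fin_verts by (intro card_mono) auto
  then have lower: "real (card good) * card T \<le> ?x" unfolding cWX by (simp flip: of_nat_mult)
  have "verts G \<inter> X \<subseteq> (W \<inter> X) \<union> (verts G - W)" by auto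
  then have "card (verts G \<inter> X) \<le> card (W \<inter> X) + card (verts G - W)"
    by (rule order_trans[OF card_mono card_Un_le, rotated]) (use fin_verts W in \<open>auto intro: finite_subset\<close>)
  moreover have "card (verts G - W) = card (verts G) - card W" "card W \<le> card (verts G)"
    using W fin_verts by (auto intro: card_Diff_subset card_mono finite_subset)
  ultimately have u: "card (verts G \<inter> X) \<le> card good * card T + (card (verts G) - 2 * d * card good)"
    and c: "2 * d * card good \<le> card (verts G)"
    unfolding cWX cW by simp_all
  have le: "2 * real d * real (card good) \<le> ?V" using of_nat_mono[OF c, where 'a = real] by simp
  have upper: "?x \<le> real (card good) * card T + (?V - 2 * real d * card good)"
    using of_nat_mono[OF u, where 'a = real] c by (simp add: of_nat_diff)
  define \<tau> where "\<tau> = real (card T) / (2 * real d)"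
  have \<tau>: "0 \<le> \<tau>" "\<tau> \<le> 1" using t d by (auto simp: \<tau>_def divide_le_eq)
  have T: "real (card T) = 2 * real d * \<tau>" using d by (simp add: \<tau>_def)
  let ?D = "?V - 2 * real d * real (card good)"
  have D: "0 \<le> ?D" using le by simp
  \<comment> \<open>The \<open>?D\<close> vertices outside the good part contribute between
    \<open>0\<close> and \<open>?D\<close> to \<open>?x\<close>, against \<open>\<tau> * ?D\<close>
    in the ideal count; both differences are at most \<open>?D\<close>.\<close>
  have "?x - \<tau> * ?V \<le> ?D * (1 - \<tau>)" using upper unfolding T by (simp add: algebra_simps)
  also have "\<dots> \<le> ?D" using \<tau> D by (intro mult_left_le) auto
  finally have 1: "?x - \<tau> * ?V \<le> ?D" .
  have "\<tau> * ?V - ?x \<le> ?D * \<tau>" using lower unfolding T by (simp add: algebra_simps)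
  also have "\<dots> \<le> ?D" using \<tau> D by (intro mult_left_le) auto
  finally have "\<bar>?x - \<tau> * ?V\<bar> \<le> ?D" using 1 by simp
  then have "\<bar>(?x - \<tau> * ?V) / ?V\<bar> \<le> ?D / ?V" using Vpos by (simp add: abs_divide divide_right_mono)
  moreover have "(?x - \<tau> * ?V) / ?V = ?x / ?V - \<tau>" using Vpos by (simp add: diff_divide_distrib)
  moreover have "chain_count d \<alpha> r / (2 * real d) = \<tau>"
    unfolding \<tau>_def chain_count_def T_def ..
  ultimately show ?thesis unfolding prob by simp
qed

text \<open>The positions whose ball of radius \<open>r\<close> stays inside one chain.\<close>

definition bulk :: "nat \<Rightarrow> nat \<Rightarrow> nat \<Rightarrow> int set" where
  "bulk d L r = (\<lambda>(c, j). int c * int L + int j) ` ({..<d} \<times> {Suc r..<L - Suc r})"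

lemma card_bulk: "card (bulk d L r) = d * (L - 2 * Suc r)"
proof -
  have "inj_on (\<lambda>(c, j). int c * int L + int j) ({..<d} \<times> {Suc r..<L - Suc r})"
  proof (rule inj_onI, clarify)
    fix c j c' j'
    assume j: "j \<in> {Suc r..<L - Suc r}" "j' \<in> {Suc r..<L - Suc r}"
      and "int c * int L + int j = int c' * int L + int j'"
    then have eq: "c * L + j = c' * L + j'" by (simp flip: of_nat_mult of_nat_add)
    have "j < L" "j' < L" using j by auto
    then have "(c * L + j) div L = c" "(c' * L + j') div L = c'" by simp_all
    then have "c = c'" using eq by simp
    then show "c = c' \<and> j = j'" using eq by simp
  qed
  then show ?thesis
    by (simp add: bulk_def card_image card_cartesian_product mult_2)
qed

text \<open>The margin \<open>Suc r\<close> instead of \<open>r\<close> leaves a neighbour on either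
  side: \<open>p + k\<close> is neither the first nor the last gadget of its chain.\<close>

lemma bulk_shift:
  assumes "p \<in> bulk d L r" "\<bar>k\<bar> \<le> int r"
  shows "1 \<le> p + k" "p + k + 1 < int (d * L)" "\<not> int L dvd p + k" "\<not> int L dvd p + k + 1"
proof -
  from assms(1) obtain c j where p: "p = int c * int L + int j" "c < d" "Suc r \<le> j" "j < L - Suc r"
    by (auto simp: bulk_def)
  define m where "m = int j + k"
  have m: "1 \<le> m" "m + 1 < int L" using p assms(2) by (auto simp: m_def)
  have pk: "p + k = int c * int L + m" by (simp add: p(1) m_def)
  have "0 \<le> int c * int L" by simp
  then show "1 \<le> p + k" unfolding pk using m by linarith
  have "int (Suc c * L) \<le> int (d * L)" using p(2) by (intro of_nat_mono mult_right_mono) auto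
  then have "int c * int L + int L \<le> int (d * L)" by (simp add: algebra_simps)
  then show "p + k + 1 < int (d * L)" unfolding pk using m by linarith
  have "\<not> int L dvd m" "\<not> int L dvd m + 1" using m by (auto dest: zdvd_imp_le)
  then show "\<not> int L dvd p + k" "\<not> int L dvd p + k + 1"
    unfolding pk by (simp_all add: add.assoc dvd_add_right_iff)
qed

text \<open>This bounds the number of gadget vertices outside the bulk. If \<open>L\<close> is less
  than twice \<open>Suc r\<close>, the truncated subtraction makes the bulk empty and the bound
  still holds.\<close>

lemma bulk_deficit: "2 * (real d * (real d * real L)) - 2 * real d * card (bulk d L r) \<le> 4 * (real d)\<^sup>2 * Suc r"
proof -
  define m where "m = L - 2 * Suc r"
  have "L \<le> m + 2 * Suc r" by (simp add: m_def)
  then have "real L \<le> real (m + 2 * Suc r)" by (rule of_nat_mono)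
  then have "2 * (real d * real d) * real L \<le> 2 * (real d * real d) * real (m + 2 * Suc r)"
    by (rule mult_left_mono) simp
  then show ?thesis
    unfolding card_bulk m_def[symmetric] by (simp add: algebra_simps power2_eq_square)
qed

text \<open>The cycle is cut into \<open>d\<close> stretches of length \<open>L\<close>, so the same
  \<open>bulk\<close> serves. The summand \<open>2\<close> stands for the two hub vertices of the
  theta graph, giving both families one error bound.\<close>

lemma ball_prob_cycle:
  assumes "0 < d" "0 < L"
  shows "\<bar>ball_prob (cycle_graph d (d * L)) \<alpha> r - chain_count d \<alpha> r / (2 * real d)\<bar> \<le>
    (4 * (real d)\<^sup>2 * Suc r + 2) / card (verts (cycle_graph d (d * L)))"
proof -
  have "\<bar>ball_prob (cycle_graph d (d * L)) \<alpha> r - chain_count d \<alpha> r / (2 * real d)\<bar> \<le>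
    (real (card (verts (cycle_graph d (d * L)))) - 2 * real d * card (bulk d L r)) /
      card (verts (cycle_graph d (d * L)))"
  proof (rule ball_prob_estimate[OF _ _ assms(1) _ _ _ _ _ cycle_graph_def])
    show "bulk d L r \<subseteq> {0..<int (d * L)}" using bulk_shift[where k = 0] by fastforce
    fix p k assume *: "p \<in> bulk d L r" "\<bar>k\<bar> \<le> int r"
    note i = bulk_shift[OF *]
    show "p + k \<in> {0..<int (d * L)}" using i(1,2) by simp
    then show "cycle_links (d * L) `` {p + k} = {p + k - 1}" "(cycle_links (d * L))\<inverse> `` {p + k} = {p + k + 1}"
      using i(1,2) by (simp_all add: cycle_links_Image del: of_nat_mult)
  qed (use assms in auto)
  also have "\<dots> \<le> (4 * (real d)\<^sup>2 * Suc r + 2) / card (verts (cycle_graph d (d * L)))"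
    using bulk_deficit[of d L r] by (intro divide_right_mono) (simp_all add: card_verts_cycle)
  finally show ?thesis .
qed

lemma ball_prob_theta:
  assumes "0 < d" "0 < L"
  shows "\<bar>ball_prob (theta_graph d L) \<alpha> r - chain_count d \<alpha> r / (2 * real d)\<bar> \<le>
    (4 * (real d)\<^sup>2 * Suc r + 2) / card (verts (theta_graph d L))"
proof -
  have "\<bar>ball_prob (theta_graph d L) \<alpha> r - chain_count d \<alpha> r / (2 * real d)\<bar> \<le>
    (real (card (verts (theta_graph d L))) - 2 * real d * card (bulk d L r)) /
      card (verts (theta_graph d L))"
  proof (rule ball_prob_estimate[OF _ _ assms(1) _ _ _ _ _ theta_graph_def])
    show "bulk d L r \<subseteq> {0..<int (d * L)}" using bulk_shift[where k = 0] by fastforce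
    fix p k assume *: "p \<in> bulk d L r" "\<bar>k\<bar> \<le> int r"
    note i = bulk_shift[OF *]
    show "p + k \<in> {0..<int (d * L)}" using i(1,2) by simp
    then show "theta_links d L `` {p + k} = {p + k - 1}" "(theta_links d L)\<inverse> `` {p + k} = {p + k + 1}"
      using i by (simp_all add: theta_links_Image)
  qed (use assms in auto)
  also have "\<dots> \<le> (4 * (real d)\<^sup>2 * Suc r + 2) / card (verts (theta_graph d L))"
    using bulk_deficit[of d L r] by (intro divide_right_mono) (simp_all add: card_verts_theta)
  finally show ?thesis .
qed

text \<open>\<open>Suc\<close> keeps the chain length positive.\<close>

definition alternating_graphs :: "nat \<Rightarrow> nat \<Rightarrow> nat graph" where
  "alternating_graphs d n =
     (if even n then cycle_graph d (d * Suc (n div 2)) else theta_graph d (Suc (n div 2)))"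

text \<open>Both families have the same limit \<open>?c\<close>, with an error of a constant divided
  by the number of vertices, which is at least \<open>n\<close>.\<close>

lemma BS_convergent_alternating:
  assumes "0 < d"
  shows "BS_convergent (alternating_graphs d)" "alternating_graphs d n \<in> regular_bipartite_graphs d"
proof -
  show reg: "alternating_graphs d n \<in> regular_bipartite_graphs d" for n
    using assms by (simp add: alternating_graphs_def cycle_graph_regular_bipartite theta_graph_regular_bipartite)
  have "convergent (\<lambda>n. ball_prob (alternating_graphs d n) \<alpha> r)" for \<alpha> :: "nat rooted_graph" and r
  proof -
    let ?c = "chain_count d \<alpha> r / (2 * real d)" and ?C = "4 * (real d)\<^sup>2 * Suc r + 2"
    have "norm (ball_prob (alternating_graphs d n) \<alpha> r - ?c) \<le> ?C / real n" if "0 < n" for n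
    proof -
      have "\<bar>ball_prob (alternating_graphs d n) \<alpha> r - ?c\<bar> \<le> ?C / card (verts (alternating_graphs d n))"
        using ball_prob_cycle[OF assms, of "Suc (n div 2)"] ball_prob_theta[OF assms, of "Suc (n div 2)"]
        by (simp add: alternating_graphs_def)
      also have "n \<le> 2 * (d * (d * Suc (n div 2)))"
      proof -
        have "1 * (1 * Suc (n div 2)) \<le> d * (d * Suc (n div 2))" using assms by (intro mult_mono) auto
        then have "2 * Suc (n div 2) \<le> 2 * (d * (d * Suc (n div 2)))" by simp
        moreover have "n \<le> 2 * Suc (n div 2)" by simp
        ultimately show ?thesis by (rule order_trans[rotated])
      qed
      then have "n \<le> card (verts (alternating_graphs d n))"
        by (auto simp: alternating_graphs_def card_verts_cycle card_verts_theta)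
      then have "?C / card (verts (alternating_graphs d n)) \<le> ?C / real n"
        using that by (intro divide_left_mono) auto
      finally show ?thesis by simp
    qed
    then have "eventually (\<lambda>n. norm (ball_prob (alternating_graphs d n) \<alpha> r - ?c) \<le> ?C / real n) sequentially"
      using eventually_gt_at_top[of 0] by (rule eventually_mono[rotated])
    then have "(\<lambda>n. ball_prob (alternating_graphs d n) \<alpha> r - ?c) \<longlonglongrightarrow> 0"
      by (rule Lim_null_comparison) (rule lim_const_over_n)
    then show ?thesis unfolding convergent_def LIM_zero_iff by blast
  qed
  then show "BS_convergent (alternating_graphs d)"
    using reg unfolding BS_convergent_def bounded_degrees_def regular_bipartite_graphs_def regular_def
    by (auto intro!: exI[of _ d])
qed

section \<open>Entropy\<close>

lemma pm_entropy_cycle: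
  assumes "3 \<le> d" "0 < L"
  shows "ln (n_in d) / (2 * real d) \<le> pm_entropy (cycle_graph d (d * L))"
proof -
  have A: "0 < n_in d" using n_out_less_n_in[OF assms(1)] by simp
  have "real (n_in d ^ (d * L)) \<le> pm (cycle_graph d (d * L))"
    using pm_cycle_lower[of d "d * L"] assms by (intro of_nat_mono) auto
  moreover have "0 < real (n_in d ^ (d * L))" using A by simp
  ultimately have "ln (real (n_in d ^ (d * L))) \<le> ln (pm (cycle_graph d (d * L)))"
    by (rule ln_mono)
  then have "real d * real L * ln (n_in d) \<le> ln (pm (cycle_graph d (d * L)))"
    using A by (simp add: ln_realpow)
  then have "real d * real L * ln (n_in d) / (2 * (real d * (real d * real L))) \<le> pm_entropy (cycle_graph d (d * L))"
    unfolding pm_entropy_def card_verts_cycle of_nat_mult of_nat_numeral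
    by (rule divide_right_mono) simp
  then show ?thesis using assms by (simp add: field_simps)
qed

lemma pm_entropy_theta:
  assumes "3 \<le> d" "0 < L"
  shows "pm_entropy (theta_graph d L) \<le>
    ln d / (2 * (real d)\<^sup>2) / L + (ln (n_out d) + (real d - 1) * ln (n_in d)) / (2 * (real d)\<^sup>2)"
proof -
  have A: "0 < n_in d" using n_out_less_n_in[OF assms(1)] by simp
  have B: "0 < n_out d" by (rule n_out_pos)
  let ?b = "d * (n_out d ^ L * n_in d ^ ((d - 1) * L))"
  let ?s = "ln d + L * (ln (n_out d) + (real d - 1) * ln (n_in d))"
  have b: "0 < ?b" using A B assms by simp
  have "ln (pm (theta_graph d L)) \<le> ln ?b"
  proof (cases "pm (theta_graph d L) = 0")
    \<comment> \<open>Here \<open>ln 0 = 0\<close>, and the bound holds because \<open>?b\<close> is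
      at least 1.\<close>
    case True
    then show ?thesis using b by (simp add: Suc_le_eq flip: of_nat_mult of_nat_power)
  next
    case False
    have "real (pm (theta_graph d L)) \<le> real ?b"
      using pm_theta_upper[of d L] assms by (intro of_nat_mono) auto
    then show ?thesis using False b by (subst ln_le_cancel_iff) (auto simp del: of_nat_mult)
  qed
  also have "ln ?b = ?s"
    using A B assms by (simp add: ln_mult ln_realpow algebra_simps of_nat_diff)
  finally have le: "ln (pm (theta_graph d L)) \<le> ?s" .
  have "0 \<le> ?s" using A B assms by (auto simp: Suc_le_eq intro!: add_nonneg_nonneg mult_nonneg_nonneg)
  have "pm_entropy (theta_graph d L) \<le> ?s / card (verts (theta_graph d L))"
    unfolding pm_entropy_def using le by (intro divide_right_mono) auto
  \<comment> \<open>Since \<open>?s\<close> is nonnegative, dropping the two hub vertices from the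
    denominator only enlarges the quotient.\<close>
  also have "\<dots> \<le> ?s / (2 * (real d * (real d * real L)))"
    using \<open>0 \<le> ?s\<close> assms by (intro divide_left_mono) (auto simp: card_verts_theta simp flip: of_nat_mult)
  also have "\<dots> = ln d / (2 * (real d)\<^sup>2) / L + (ln (n_out d) + (real d - 1) * ln (n_in d)) / (2 * (real d)\<^sup>2)"
    using assms by (simp add: field_simps power2_eq_square)
  finally show ?thesis .
qed

theorem theorem1p8:
  fixes d :: nat
  assumes "d \<ge> 3"
  shows "\<not> estimable (regular_bipartite_graphs d) pm_entropy"
proof
  let ?A = "ln (real (n_in d))" and ?B = "ln (real (n_out d))"
  have d: "0 < d" using assms by simp
  assume "estimable (regular_bipartite_graphs d) pm_entropy"
  then have "convergent (\<lambda>n. pm_entropy (alternating_graphs d n))"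
    using BS_convergent_alternating[OF d] unfolding estimable_def by blast
  then obtain l where l: "(\<lambda>n. pm_entropy (alternating_graphs d n)) \<longlonglongrightarrow> l"
    unfolding convergent_def by blast
  have "(\<lambda>k. pm_entropy (alternating_graphs d (2 * k))) \<longlonglongrightarrow> l"
    using LIMSEQ_subseq_LIMSEQ[OF l, of "\<lambda>k. 2 * k"] by (simp add: strict_mono_def comp_def)
  moreover have "?A / (2 * real d) \<le> pm_entropy (alternating_graphs d (2 * k))" for k
    using pm_entropy_cycle[OF assms, of "Suc k"] by (simp add: alternating_graphs_def)
  ultimately have lower: "?A / (2 * real d) \<le> l" by (intro LIMSEQ_le_const) auto
  have odd: "(\<lambda>k. pm_entropy (alternating_graphs d (2 * k + 1))) \<longlonglongrightarrow> l"
    using LIMSEQ_subseq_LIMSEQ[OF l, of "\<lambda>k. 2 * k + 1"] by (simp add: strict_mono_def comp_def)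
  have "(\<lambda>k. ln d / (2 * (real d)\<^sup>2) / Suc k + (?B + (real d - 1) * ?A) / (2 * (real d)\<^sup>2)) \<longlonglongrightarrow>
      0 + (?B + (real d - 1) * ?A) / (2 * (real d)\<^sup>2)"
    by (intro tendsto_add tendsto_const LIMSEQ_Suc[OF lim_const_over_n])
  moreover have "pm_entropy (alternating_graphs d (2 * k + 1)) \<le>
      ln d / (2 * (real d)\<^sup>2) / Suc k + (?B + (real d - 1) * ?A) / (2 * (real d)\<^sup>2)" for k
    using pm_entropy_theta[OF assms, of "Suc k"] by (simp add: alternating_graphs_def)
  ultimately have "l \<le> 0 + (?B + (real d - 1) * ?A) / (2 * (real d)\<^sup>2)"
    using LIMSEQ_le[OF odd] by blast
  then have "?A / (2 * real d) \<le> (?B + (real d - 1) * ?A) / (2 * (real d)\<^sup>2)" using lower by simp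
  \<comment> \<open>Over the common denominator \<open>2 * d^2\<close> the cycle contributes
    \<open>d * ?A\<close> and the theta graph \<open>?B + (d - 1) * ?A\<close>: one chain in
    \<open>d\<close> makes the difference.\<close>
  then have "?A \<le> ?B" using d by (simp add: field_simps power2_eq_square)
  moreover have "?B < ?A" using n_out_less_n_in[OF assms] n_out_pos[of d] by simp
  ultimately show False by simp
qed

end
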